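(* Suppose $A$ is a CM-order and $L$ is an $A$-lattice. Then: (i) if $L$ is invertible, the map from the set of $A$-isomorphisms $A\to L$ (from the standard $A$-lattice) to the set of short vectors of $L$ given by $f\mapsto f(1)$ is bijective; (ii) if $L$ is invertible and $e\in L$ is short, then $e$ generates $L$ as an $A$-module; (iii) $L$ is $A$-isomorphic to the standard $A$-lattice if and only if $L$ is invertible and has a short vector; (iv) if $L$ is invertible and $e\in L$ is short, then the map $\mu(A)\to\{\text{short vectors of }L\}$, $\zeta\mapsto\zeta e$, is bijective.
   Context: An order is a commutative ring whose additive group is isomorphic to $\mathbb{Z}^n$ for some $n\ge 0$. A CM-order is an order $A$ with no non-zero nilpotent elements, equipped with a ring automorphism $x\mapsto \bar{x}$ such that $\psi(\bar{x})=\overline{\psi(x)}$ for all $x\in A$ and all ring homomorphisms $\psi:A\to\mathbb{C}$. $\mu(A)$ is the group of roots of unity of $A$. A lattice is a finitely generated free abelian group with a positive definite symmetric $\mathbb{Z}$-valued bilinear form $\langle\cdot,\cdot\rangle$. An $A$-lattice is a lattice $L$ with an $A$-module structure such that $\langle ax,y\rangle=\langle x,\bar a y\rangle$ for all $a\in A$, $x,y\in L$; an $A$-isomorphism is an inner-product-preserving $A$-module isomorphism. The standard $A$-lattice is $A$ with $\langle a,b\rangle=\mathrm{Tr}_{A/\mathbb{Z}}(a\bar b)$. Let $A_{\mathbb Q}=A\otimes\mathbb{Q}$ and $\hat A=\{a\in A_{\mathbb Q}:\mathrm{Tr}(aA)\subset\mathbb{Z}\}$. For $x,y\in L$, $x\bar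 y$ denotes the unique $z\in\hat A$ with $\mathrm{Tr}(az)=\langle ax,y\rangle$ for all $a\in A$. Let $\bar L$ be a copy $\{\bar y:y\in L\}$ of the group $L$ with $A$-action $a\cdot\bar y=\overline{\bar a y}$; then $x\otimes\bar y\mapsto x\bar y$ defines an $A$-linear map $\varphi_L:L\otimes_A\bar L\to\hat A$. $L$ is invertible if $\varphi_L$ takes values in $A$ and $\varphi_L:L\otimes_A\bar L\to A$ is an $A$-module isomorphism. A vector $x\in L$ is short if $x\bar x=1$. *)

theory Defs
  imports
    "HOL-Algebra.Algebra"
    "HOL-Algebra.Free_Abelian_Groups"
    "HOL-Algebra.Algebraic_Closure_Type"
    Complex_Main
begin

section \<open>CM-orders\<close>

definition free_fg :: "('a, 'm) monoid_scheme \<Rightarrow> bool" where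
  "free_fg G \<longleftrightarrow> (\<exists>n::nat. G \<cong> product_group {..<n} (\<lambda>_. integer_group))"

text \<open>The zero ring is an order (rank 0); \<^const>\<open>cring\<close> does not exclude it.\<close>

definition is_order :: "('a, 'm) ring_scheme \<Rightarrow> bool" where
  "is_order A \<longleftrightarrow> cring A \<and> free_fg (add_monoid A)"

record 'a bar_ring = "'a ring" +
  bar :: "'a \<Rightarrow> 'a"

definition CM_order :: "'a bar_ring \<Rightarrow> bool" where
  "CM_order A \<longleftrightarrow>
     is_order A \<and>
     (\<forall>x \<in> carrier A. \<forall>n::nat. x [^]\<^bsub>A\<^esub> n = \<zero>\<^bsub>A\<^esub> \<longrightarrow> x = \<zero>\<^bsub>A\<^esub>) \<and>
     bar A \<in> ring_iso A A \<and>
     (\<forall>x \<in> carrier A. \<forall>\<psi> \<in> ring_hom A (ring_of_type_algebra :: complex ring).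
        \<psi> (bar A x) = cnj (\<psi> x))"

definition mu_group :: "('a, 'm) ring_scheme \<Rightarrow> 'a set" where
  "mu_group A = {\<zeta> \<in> carrier A. \<exists>n::nat. n > 0 \<and> \<zeta> [^]\<^bsub>A\<^esub> n = \<one>\<^bsub>A\<^esub>}"

text \<open>The trace over \<open>\<int>\<close> of multiplication by \<open>a\<close>: the sum of the diagonal entries of its matrix
  in the basis given by an isomorphism from the additive group to \<open>\<int>\<^sup>n\<close>. The choice of basis does
  not affect the value.\<close>

definition order_trace :: "('a, 'm) ring_scheme \<Rightarrow> 'a \<Rightarrow> int" where
  "order_trace A a =
     (let (n, h) = (SOME (n::nat, h). h \<in> iso (add_monoid A) (product_group {..<n} (\<lambda>_. integer_group)))
      in \<Sum>i<n. h (a \<otimes>\<^bsub>A\<^esub> inv_into (carrier A) h (\<lambda>j\<in>{..<n}. if j = i then 1 else 0)) i)"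


section \<open>Lattices\<close>

record ('a, 'l) form_module = "('a, 'l) module" +
  form :: "'l \<Rightarrow> 'l \<Rightarrow> int"

definition is_lattice :: "('a, 'l) form_module \<Rightarrow> bool" where
  "is_lattice L \<longleftrightarrow>
     abelian_group L \<and> free_fg (add_monoid L) \<and>
     (\<forall>x \<in> carrier L. \<forall>y \<in> carrier L. \<forall>z \<in> carrier L.
        form L (x \<oplus>\<^bsub>L\<^esub> y) z = form L x z + form L y z \<and>
        form L z (x \<oplus>\<^bsub>L\<^esub> y) = form L z x + form L z y) \<and>
     (\<forall>x \<in> carrier L. \<forall>y \<in> carrier L. form L x y = form L y x) \<and>
     (\<forall>x \<in> carrier L. x \<noteq> \<zero>\<^bsub>L\<^esub> \<longrightarrow> form L x x > 0)"

definition A_lattice :: "'a bar_ring \<Rightarrow> ('a, 'l) form_module \<Rightarrow> bool" where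
  "A_lattice A L \<longleftrightarrow>
     is_lattice L \<and> module A L \<and>
     (\<forall>a \<in> carrier A. \<forall>x \<in> carrier L. \<forall>y \<in> carrier L.
        form L (a \<odot>\<^bsub>L\<^esub> x) y = form L x (bar A a \<odot>\<^bsub>L\<^esub> y))"

definition module_iso ::
  "('a, 'r) ring_scheme \<Rightarrow> ('a, 'b, 'm) module_scheme \<Rightarrow> ('a, 'c, 'n) module_scheme \<Rightarrow> ('b \<Rightarrow> 'c) set"
  where "module_iso A M N =
     {h \<in> iso (add_monoid M) (add_monoid N).
        \<forall>a \<in> carrier A. \<forall>x \<in> carrier M. h (a \<odot>\<^bsub>M\<^esub> x) = a \<odot>\<^bsub>N\<^esub> h x}"

text \<open>Maps are taken extensional, so that equality of maps is equality on the carrier.\<close>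

definition A_isos ::
  "'a bar_ring \<Rightarrow> ('a, 'b) form_module \<Rightarrow> ('a, 'c) form_module \<Rightarrow> ('b \<Rightarrow> 'c) set" where
  "A_isos A L M =
     {h \<in> module_iso A L M \<inter> extensional (carrier L).
        \<forall>x \<in> carrier L. \<forall>y \<in> carrier L. form M (h x) (h y) = form L x y}"

definition A_isomorphic ::
  "'a bar_ring \<Rightarrow> ('a, 'b) form_module \<Rightarrow> ('a, 'c) form_module \<Rightarrow> bool" where
  "A_isomorphic A L M \<longleftrightarrow> A_isos A L M \<noteq> {}"

definition as_module :: "('b, 'm) ring_scheme \<Rightarrow> ('a \<Rightarrow> 'b \<Rightarrow> 'b) \<Rightarrow> ('a, 'b) module" where
  "as_module R s =
     \<lparr>carrier = carrier R, monoid.mult = monoid.mult R, one = one R, ring.zero = ring.zero R, add = add R, module.smult = s\<rparr>"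

definition standard_lattice :: "'a bar_ring \<Rightarrow> ('a, 'a) form_module" where
  "standard_lattice A =
     module.extend (as_module A (monoid.mult A))
       (form_module.fields (\<lambda>a b. order_trace A (a \<otimes>\<^bsub>A\<^esub> bar A b)))"

definition conj_module :: "'a bar_ring \<Rightarrow> ('a, 'l) form_module \<Rightarrow> ('a, 'l) form_module" where
  "conj_module A L = L\<lparr>module.smult := \<lambda>a y. bar A a \<odot>\<^bsub>L\<^esub> y\<rparr>"


section \<open>Tensor products\<close>

text \<open>\<open>M \<otimes>\<^sub>R N\<close> is the free abelian group on \<open>carrier M \<times> carrier N\<close> modulo the usual relations;
  its elements are cosets of \<open>tensor_ker R M N\<close>.\<close>

definition tensor_rels ::
  "('r, 'x) ring_scheme \<Rightarrow> ('r, 'm, 'p) module_scheme \<Rightarrow> ('r, 'n, 'q) module_scheme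
     \<Rightarrow> ('m \<times> 'n \<Rightarrow>\<^sub>0 int) set" where
  "tensor_rels R M N =
     {frag_of (x \<oplus>\<^bsub>M\<^esub> x', y) - frag_of (x, y) - frag_of (x', y) | x x' y.
        x \<in> carrier M \<and> x' \<in> carrier M \<and> y \<in> carrier N} \<union>
     {frag_of (x, y \<oplus>\<^bsub>N\<^esub> y') - frag_of (x, y) - frag_of (x, y') | x y y'.
        x \<in> carrier M \<and> y \<in> carrier N \<and> y' \<in> carrier N} \<union>
     {frag_of (r \<odot>\<^bsub>M\<^esub> x, y) - frag_of (x, r \<odot>\<^bsub>N\<^esub> y) | r x y.
        r \<in> carrier R \<and> x \<in> carrier M \<and> y \<in> carrier N}"

definition tensor_free ::
  "('r, 'm, 'p) module_scheme \<Rightarrow> ('r, 'n, 'q) module_scheme \<Rightarrow> ('m \<times> 'n \<Rightarrow>\<^sub>0 int) monoid" where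
  "tensor_free M N = free_Abelian_group (carrier M \<times> carrier N)"

definition tensor_ker ::
  "('r, 'x) ring_scheme \<Rightarrow> ('r, 'm, 'p) module_scheme \<Rightarrow> ('r, 'n, 'q) module_scheme
     \<Rightarrow> ('m \<times> 'n \<Rightarrow>\<^sub>0 int) set" where
  "tensor_ker R M N = generate (tensor_free M N) (tensor_rels R M N)"

definition pure_tensor ::
  "('r, 'x) ring_scheme \<Rightarrow> ('r, 'm, 'p) module_scheme \<Rightarrow> ('r, 'n, 'q) module_scheme
     \<Rightarrow> 'm \<Rightarrow> 'n \<Rightarrow> ('m \<times> 'n \<Rightarrow>\<^sub>0 int) set" where
  "pure_tensor R M N x y = tensor_ker R M N #>\<^bsub>tensor_free M N\<^esub> frag_of (x, y)"

text \<open>Scalars act by \<open>r (x \<otimes> y) = r x \<otimes> y\<close>. The fields \<^const>\<open>monoid.mult\<close> and \<^const>\<open>one\<close> give the tensor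
  product of algebras, \<open>(x \<otimes> y) (x' \<otimes> y') = x x' \<otimes> y y'\<close>; they are meaningless (and not used) when
  \<open>M\<close> and \<open>N\<close> are just modules. Multiplying by \<^const>\<open>tensor_ker\<close> turns a set of representatives of
  one class into that class.\<close>

definition tensor ::
  "('r, 'x) ring_scheme \<Rightarrow> ('r, 'm, 'p) module_scheme \<Rightarrow> ('r, 'n, 'q) module_scheme
     \<Rightarrow> ('r, ('m \<times> 'n \<Rightarrow>\<^sub>0 int) set) module" where
  "tensor R M N =
     (let F = tensor_free M N; K = tensor_ker R M N; Q = F Mod K in
      \<lparr>carrier = carrier Q,
       monoid.mult = (\<lambda>U V. K <#>\<^bsub>F\<^esub>
          {frag_extend (\<lambda>(x, y). frag_extend (\<lambda>(x', y'). frag_of (x \<otimes>\<^bsub>M\<^esub> x', y \<otimes>\<^bsub>N\<^esub> y')) v) u | u v.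
             u \<in> U \<and> v \<in> V}),
       one = pure_tensor R M N \<one>\<^bsub>M\<^esub> \<one>\<^bsub>N\<^esub>,
       ring.zero = one Q,
       add = monoid.mult Q,
       module.smult = (\<lambda>r U. K <#>\<^bsub>F\<^esub> frag_extend (\<lambda>(x, y). frag_of (r \<odot>\<^bsub>M\<^esub> x, y)) ` U)\<rparr>)"

text \<open>The additive map on a tensor product with \<open>x \<otimes> y \<mapsto> f x y\<close>, for \<open>f\<close> balanced biadditive with
  values in \<open>P\<close>. All representatives of a class then have the same value.\<close>

definition tensor_lift ::
  "('c, 'k) ring_scheme \<Rightarrow> ('m \<Rightarrow> 'n \<Rightarrow> 'c) \<Rightarrow> ('m \<times> 'n \<Rightarrow>\<^sub>0 int) set \<Rightarrow> 'c" where
  "tensor_lift P f U =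
     the_elem ((\<lambda>c. \<Oplus>\<^bsub>P\<^esub>p \<in> Poly_Mapping.keys c.
                      add_pow P (Poly_Mapping.lookup c p) (f (fst p) (snd p))) ` U)"


section \<open>Extension of scalars to the rationals\<close>

abbreviation Z_ring :: "int ring" where
  "Z_ring \<equiv> ring_of_type_algebra"

definition Z_alg :: "('a, 'm) ring_scheme \<Rightarrow> (int, 'a) module" where
  "Z_alg A = as_module A (add_pow A)"

abbreviation Q_ring :: "rat ring" where
  "Q_ring \<equiv> ring_of_type_algebra"

type_synonym 'a rationalized = "('a \<times> rat \<Rightarrow>\<^sub>0 int) set"

definition AQ :: "('a, 'm) ring_scheme \<Rightarrow> (int, 'a rationalized) module" where
  "AQ A = tensor Z_ring (Z_alg A) (Z_alg Q_ring)"

definition to_AQ :: "('a, 'm) ring_scheme \<Rightarrow> 'a \<Rightarrow> 'a rationalized" where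
  "to_AQ A a = pure_tensor Z_ring (Z_alg A) (Z_alg Q_ring) a 1"

definition trace_AQ :: "('a, 'm) ring_scheme \<Rightarrow> 'a rationalized \<Rightarrow> rat" where
  "trace_AQ A = tensor_lift Q_ring (\<lambda>a q. of_int (order_trace A a) * q)"

definition A_hat :: "('a, 'm) ring_scheme \<Rightarrow> 'a rationalized set" where
  "A_hat A = {z \<in> carrier (AQ A). \<forall>a \<in> carrier A. trace_AQ A (z \<otimes>\<^bsub>AQ A\<^esub> to_AQ A a) \<in> \<int>}"


section \<open>Invertible lattices and short vectors\<close>

text \<open>\<open>herm A L x y\<close> is the element written \<open>x y\<close> with a bar over \<open>y\<close>.\<close>

definition herm :: "'a bar_ring \<Rightarrow> ('a, 'l) form_module \<Rightarrow> 'l \<Rightarrow> 'l \<Rightarrow> 'a rationalized" where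
  "herm A L x y =
     (THE z. z \<in> A_hat A \<and>
        (\<forall>a \<in> carrier A. trace_AQ A (to_AQ A a \<otimes>\<^bsub>AQ A\<^esub> z) = of_int (form L (a \<odot>\<^bsub>L\<^esub> x) y)))"

definition phi_map :: "'a bar_ring \<Rightarrow> ('a, 'l) form_module \<Rightarrow> ('l \<times> 'l \<Rightarrow>\<^sub>0 int) set \<Rightarrow> 'a rationalized" where
  "phi_map A L = tensor_lift (AQ A) (herm A L)"

text \<open>\<open>A\<close> is identified with its image in \<^term>\<open>AQ A\<close>: \<^const>\<open>inv_into\<close> reads an element of that image as
  an element of \<open>A\<close>.\<close>

definition invertible_lattice :: "'a bar_ring \<Rightarrow> ('a, 'l) form_module \<Rightarrow> bool" where
  "invertible_lattice A L \<longleftrightarrow>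
     (let T = tensor A L (conj_module A L) in
      phi_map A L ` carrier T \<subseteq> to_AQ A ` carrier A \<and>
      inv_into (carrier A) (to_AQ A) \<circ> phi_map A L \<in> module_iso A T (as_module A (monoid.mult A)))"

definition short_vectors :: "'a bar_ring \<Rightarrow> ('a, 'l) form_module \<Rightarrow> 'l set" where
  "short_vectors A L = {x \<in> carrier L. herm A L x x = \<one>\<^bsub>AQ A\<^esub>}"

end

(* The standard trace form Tr(ab) of a reduced order A is nondegenerate: if Tr(ax) = 0 for all a, then
   every power of multiplication by x has trace 0, so x is nilpotent. Hence the form on an
   A-lattice L lifts uniquely to a biadditive balanced form with values in the trace dual of A.

   Let e be short and L invertible. Subtracting from x the multiple of e given by the product of x
   with e, one may assume that this product is 0. Then the tensor of x and e is in the kernel of the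
   isomorphism phi, so it vanishes, and applying the map that sends u tensor v to the product of e and v
   times u gives x = 0. So L = Ae is free with the standard form, and the short vectors are the ae with
   a times its conjugate equal to 1. The powers of such an a give vectors ae of bounded length, so a
   is a root of unity. *)

theory Submission
  imports Defs "Jordan_Normal_Form.Schur_Decomposition"
begin

no_notation fls_nth (infixl "$$" 75)
no_notation fps_nth (infixl "$" 75)

section \<open>Matrices with vanishing power traces\<close>

text \<open>The product \<open>herm\<close> lies in the extension of \<open>A\<close> to the
  rationals and is known only through its traces against \<open>A\<close>, so every identity about
  it is checked on traces. Uniqueness needs a nondegenerate trace form, which rests on
  characteristic 0: equal nonzero eigenvalues cannot cancel by their number. Existence needs
  denominators: over the integers the trace form represents in general only a multiple of a
  functional, the factor being the determinant of the Gram matrix. Invertibility speaks of a tensor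
  product, so the vanishing of a tensor has to be turned into the vanishing of a vector. The second
  factor carries the conjugate action, and this makes multiplication of \<open>u\<close> by the
  product of \<open>e\<close> and \<open>v\<close> respect the tensor relations. Two converses
  remain. A lattice \<open>A e\<close> with \<open>e\<close> short is invertible because every
  tensor can be rewritten as \<open>x\<close> tensor \<open>e\<close>. A root of unity has norm 1
  because its norm acts, for the positive definite form, as a positive operator of finite order,
  hence as the identity on \<open>e\<close>.\<close>

definition mat_trace :: "'b::comm_ring_1 mat \<Rightarrow> 'b" where
  "mat_trace M = (\<Sum>i<dim_row M. M $$ (i, i))"

lemma index_mult_mat_sum:
  assumes "M \<in> carrier_mat n n" "N \<in> carrier_mat n n" "i < n" "j < n"
  shows "(M * N) $$ (i, j) = (\<Sum>l<n. M $$ (i, l) * N $$ (l, j))"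
  using assms by (auto simp: scalar_prod_def lessThan_atLeast0 intro!: sum.cong)

lemma mat_trace_mult_commute:
  assumes "M \<in> carrier_mat n n" "N \<in> carrier_mat n n"
  shows "mat_trace (M * N) = mat_trace (N * M)"
proof -
  have "mat_trace (M * N) = (\<Sum>i<n. \<Sum>l<n. M $$ (i, l) * N $$ (l, i))"
    using assms by (simp add: mat_trace_def index_mult_mat_sum del: index_mult_mat(1))
  also have "\<dots> = (\<Sum>l<n. \<Sum>i<n. M $$ (i, l) * N $$ (l, i))"
    by (rule sum.swap)
  also have "\<dots> = mat_trace (N * M)"
    using assms by (simp add: mat_trace_def index_mult_mat_sum mult.commute del: index_mult_mat(1))
  finally show ?thesis .
qed

text \<open>The zeros below the diagonal belong to the claim so that the induction closes: in the
  product only the term \<open>l = i\<close> survives, since smaller \<open>l\<close> are killed by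
  the induction hypothesis and larger \<open>l\<close> by the zeros of \<open>B\<close> below its
  diagonal.\<close>

lemma upper_triangular_power_diag:
  assumes B: "B \<in> carrier_mat n n" and ut: "upper_triangular B" and "i < n" "j \<le> i"
  shows "(B ^\<^sub>m k) $$ (i, j) = (if i = j then (B $$ (i, i)) ^ k else 0)"
  using \<open>i < n\<close> \<open>j \<le> i\<close>
proof (induction k arbitrary: i j)
  case 0
  then show ?case using B by auto
next
  case (Suc k)
  have "(B ^\<^sub>m Suc k) $$ (i, j) = (\<Sum>l<n. (B ^\<^sub>m k) $$ (i, l) * B $$ (l, j))"
    using B Suc.prems by (simp add: index_mult_mat_sum[OF pow_carrier_mat[OF B] B] del: index_mult_mat(1))
  also have "\<dots> = (\<Sum>l<n. if l = i then (B ^\<^sub>m k) $$ (i, i) * B $$ (i, j) else 0)"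
  proof (rule sum.cong)
    fix l assume "l \<in> {..<n}"
    then show "(B ^\<^sub>m k) $$ (i, l) * B $$ (l, j)
        = (if l = i then (B ^\<^sub>m k) $$ (i, i) * B $$ (i, j) else 0)"
      using Suc B ut by (cases "l \<le> i") (auto simp: upper_triangular_def)
  qed simp
  also have "\<dots> = (B ^\<^sub>m k) $$ (i, i) * B $$ (i, j)"
    using Suc.prems by simp
  finally show ?case
    using Suc B ut by (auto simp: upper_triangular_def power_Suc2 simp del: power_Suc index_mult_mat(1))
qed

lemma strictly_upper_triangular_nilpotent:
  assumes B: "B \<in> carrier_mat n n" and "\<And>i j. i < n \<Longrightarrow> j \<le> i \<Longrightarrow> B $$ (i, j) = 0"
  shows "B ^\<^sub>m n = 0\<^sub>m n n"
proof -
  \<comment> \<open>Each further factor pushes the zeros one diagonal up; at \<open>k = n\<close>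
    the condition \<open>j < i + k\<close> covers the whole matrix.\<close>
  have "(B ^\<^sub>m k) $$ (i, j) = 0" if "i < n" "j < n" "j < i + k" for i j k
    using that
  proof (induction k arbitrary: i j)
    case 0
    then show ?case using B by simp
  next
    case (Suc k)
    have "(B ^\<^sub>m k) $$ (i, l) * B $$ (l, j) = 0" if "l < n" for l
      using Suc assms(2)[of l j] that by (cases "l < i + k") auto
    then show ?case
      using B Suc.prems by (simp add: index_mult_mat_sum[OF pow_carrier_mat[OF B] B] del: index_mult_mat(1))
  qed
  then show ?thesis
    using B by (intro eq_matI) auto
qed

text \<open>Test the power sums against a polynomial that separates \<open>es i\<close> from all
  other values. The sum of its values is a combination of power sums, but also the multiplicity of
  \<open>es i\<close> times a nonzero number, and in characteristic 0 this is nonzero.\<close>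

lemma power_sums_zero_imp_zero:
  fixes es :: "nat \<Rightarrow> 'b::field_char_0"
  assumes ps: "\<And>k. k > 0 \<Longrightarrow> (\<Sum>i<n. es i ^ k) = 0" and "i < n"
  shows "es i = 0"
proof (rule ccontr)
  assume nz: "es i \<noteq> 0"
  \<comment> \<open>0 stays in \<open>S\<close> because \<open>es i\<close> is nonzero. As a root of
    \<open>p\<close> it removes the constant term, that is the exponent 0, whose power sum
    \<open>n\<close> is not assumed to vanish.\<close>
  define S where "S = insert 0 (es ` {..<n}) - {es i}"
  define p where "p = (\<Prod>s\<in>S. [:- s, 1:])"
  have fin: "finite S" by (simp add: S_def)
  have pz: "poly p x = 0 \<longleftrightarrow> x \<in> S" for x
    using fin by (auto simp: p_def poly_prod)
  have "coeff p 0 = 0"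
    using pz[of 0] nz by (simp add: S_def poly_0_coeff_0)
  have "(\<Sum>j<n. poly p (es j)) = (\<Sum>j<n. \<Sum>k\<le>degree p. coeff p k * es j ^ k)"
    by (simp add: poly_altdef)
  also have "\<dots> = (\<Sum>k\<le>degree p. coeff p k * (\<Sum>j<n. es j ^ k))"
    by (subst sum.swap) (simp add: sum_distrib_left)
  also have "\<dots> = 0"
    using \<open>coeff p 0 = 0\<close> ps by (intro sum.neutral) (metis bot_nat_0.not_eq_extremum mult_zero_left mult_zero_right)
  finally have "(\<Sum>j<n. poly p (es j)) = 0" .
  moreover have "(\<Sum>j<n. poly p (es j)) = (\<Sum>j<n. if es j = es i then poly p (es i) else 0)"
    using pz by (intro sum.cong) (auto simp: S_def)
  moreover have "\<dots> = of_nat (card {j\<in>{..<n}. es j = es i}) * poly p (es i)"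
    by (simp add: sum.If_cases Int_def)
  moreover have "card {j\<in>{..<n}. es j = es i} \<noteq> 0"
    using \<open>i < n\<close> by auto
  moreover have "poly p (es i) \<noteq> 0"
    using pz by (simp add: S_def)
  ultimately show False by simp
qed

text \<open>In a triangular form over the complex numbers the traces of the powers are the power
  sums of the diagonal. Hence the diagonal is zero and the form is strictly triangular.\<close>

lemma traces_zero_imp_nilpotent:
  fixes M :: "complex mat"
  assumes M: "M \<in> carrier_mat n n" and tr: "\<And>k. k > 0 \<Longrightarrow> mat_trace (M ^\<^sub>m k) = 0"
  shows "M ^\<^sub>m n = 0\<^sub>m n n"
proof -
  obtain es where es: "char_poly M = (\<Prod>e\<leftarrow>es. [:- e, 1:])"
    using char_poly_factorized[OF M] by blast
  obtain B P Q where "schur_decomposition M es = (B, P, Q)"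
    by (metis prod_cases3)
  from schur_decomposition[OF M es this]
  have sim: "similar_mat_wit M B P Q" and ut: "upper_triangular B" by auto
  note D = similar_mat_witD2[OF M sim]
  note B = D(5) and P = D(6) and Q = D(7)
  have "(\<Sum>i<n. (B $$ (i, i)) ^ k) = 0" if "k > 0" for k
  proof -
    have Bk: "B ^\<^sub>m k \<in> carrier_mat n n" using B by simp
    have "mat_trace (M ^\<^sub>m k) = mat_trace (P * (B ^\<^sub>m k * Q))"
      using similar_mat_wit_pow_id[OF sim] Bk P Q by (simp add: assoc_mult_mat[of _ n n _ n _ n])
    also have "\<dots> = mat_trace (B ^\<^sub>m k * Q * P)"
      using Bk P Q by (intro mat_trace_mult_commute) auto
    also have "\<dots> = mat_trace (B ^\<^sub>m k)"
      using Bk P Q D(2) by (simp add: assoc_mult_mat[of _ n n _ n _ n] right_mult_one_mat[OF Bk])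
    also have "\<dots> = (\<Sum>i<n. (B $$ (i, i)) ^ k)"
      using Bk B ut by (simp add: mat_trace_def upper_triangular_power_diag)
    finally show ?thesis using tr[OF that] by simp
  qed
  then have "B $$ (i, i) = 0" if "i < n" for i
    using power_sums_zero_imp_zero[where n = n and es = "\<lambda>i. B $$ (i, i)"] that by blast
  then have "B ^\<^sub>m n = 0\<^sub>m n n"
    using B ut by (intro strictly_upper_triangular_nilpotent) (auto simp: le_less)
  then show ?thesis
    using similar_mat_wit_pow_id[OF sim, of n] P Q by simp
qed

section \<open>Bases of free abelian groups\<close>

lemma additive_int_fun:
  fixes g :: "int \<Rightarrow> int"
  assumes "\<And>k l. g (k + l) = g k + g l"
  shows "g k = k * g 1"
proof (induction k rule: int_induct[where k = 0])
  case base
  show ?case using assms[of 0 0] by simp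
next
  case (step1 i)
  then show ?case using assms[of i 1] by (simp add: algebra_simps)
next
  case (step2 i)
  then show ?case using assms[of "i - 1" 1] by (simp add: algebra_simps)
qed

locale z_basis = comm_group G for G (structure) +
  fixes n :: nat and h :: "'a \<Rightarrow> nat \<Rightarrow> int"
  assumes coord_iso: "h \<in> iso G (product_group {..<n} (\<lambda>_. integer_group))"
begin

text \<open>Encoded by the same \<open>inv_into\<close> term as in \<open>order_trace\<close>, so
  that the two can be identified by unfolding.\<close>

definition basis :: "nat \<Rightarrow> 'a" where
  "basis i = inv_into (carrier G) h (\<lambda>j\<in>{..<n}. if j = i then 1 else 0)"

lemma coord_bij: "bij_betw h (carrier G) ({..<n} \<rightarrow>\<^sub>E UNIV)"
  using coord_iso by (simp add: iso_def)

lemma coord_mult: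
  assumes "x \<in> carrier G" "y \<in> carrier G" "i < n"
  shows "h (x \<otimes> y) i = h x i + h y i"
  using coord_iso assms by (auto simp: iso_def hom_def)

lemma coord_eqI:
  assumes "x \<in> carrier G" "y \<in> carrier G" "\<And>i. i < n \<Longrightarrow> h x i = h y i"
  shows "x = y"
proof -
  have "h x = h y"
    using assms coord_bij by (intro PiE_ext[of _ "{..<n}" "\<lambda>_. UNIV"]) (auto simp: bij_betw_def)
  then show ?thesis
    using assms coord_bij by (auto simp: bij_betw_def inj_on_def)
qed

lemma ex_coord: "\<exists>x\<in>carrier G. \<forall>i<n. h x i = v i"
proof -
  have "restrict v {..<n} \<in> h ` carrier G"
    using coord_bij by (simp add: bij_betw_def)
  then show ?thesis
    by (metis imageE lessThan_iff restrict_apply')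
qed

lemma basis_closed [simp]: "basis i \<in> carrier G"
  and coord_basis: "j < n \<Longrightarrow> h (basis i) j = (if j = i then 1 else 0)"
proof -
  have *: "(\<lambda>j\<in>{..<n}. if j = i then 1 else 0) \<in> h ` carrier G"
    using coord_bij by (auto simp: bij_betw_def)
  show "basis i \<in> carrier G"
    unfolding basis_def by (rule inv_into_into[OF *])
  show "h (basis i) j = (if j = i then 1 else 0)" if "j < n"
    unfolding basis_def using f_inv_into_f[OF *] that by simp
qed

text \<open>Instead of forming linear combinations inside the group, the proof strips off the
  coordinates of \<open>x\<close> one at a time; on elements with a single coordinate
  \<open>f\<close> is linear by \<open>additive_int_fun\<close>.\<close>

lemma additive_expansion:
  fixes f :: "'a \<Rightarrow> int"
  assumes f: "\<And>x y. x \<in> carrier G \<Longrightarrow> y \<in> carrier G \<Longrightarrow> f (x \<otimes> y) = f x + f y"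
    and x: "x \<in> carrier G"
  shows "f x = (\<Sum>i<n. h x i * f (basis i))"
proof -
  \<comment> \<open>Induction on a bound \<open>m\<close> from which on the coordinates vanish;
    \<open>m = n\<close> is no restriction.\<close>
  have "f x = (\<Sum>i<m. h x i * f (basis i))"
    if "m \<le> n" "x \<in> carrier G" "\<And>i. m \<le> i \<Longrightarrow> i < n \<Longrightarrow> h x i = 0" for m x
    using that
  proof (induction m arbitrary: x)
    case 0
    \<comment> \<open>All coordinates are 0, so \<open>x\<close> is idempotent and
      \<open>f x = f x + f x\<close>.\<close>
    have "x = x \<otimes> x"
      using 0 by (intro coord_eqI) (auto simp: coord_mult)
    then show ?case
      using f[of x x] 0 by simp
  next
    case (Suc m)
    \<comment> \<open>\<open>z k\<close> stands for \<open>k\<close> times the basis element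
      \<open>m\<close> but is given by its coordinates; comparing coordinates shows that it is
      additive in \<open>k\<close>.\<close>
    have "\<exists>y. y \<in> carrier G \<and> (\<forall>i<n. h y i = (if i = m then k else 0))" for k
      using ex_coord[of "\<lambda>i. if i = m then k else 0"] by blast
    then obtain z where z: "\<And>k. z k \<in> carrier G"
      and hz: "\<And>k i. i < n \<Longrightarrow> h (z k) i = (if i = m then k else 0)" by metis
    have "z (k + l) = z k \<otimes> z l" for k l
      using z hz by (intro coord_eqI) (auto simp: coord_mult)
    then have fz: "f (z k) = k * f (z 1)" for k
      by (intro additive_int_fun[of "\<lambda>k. f (z k)"]) (simp add: f z)
    have z1: "z 1 = basis m"
      using z hz by (intro coord_eqI) (auto simp: coord_basis)
    obtain y where y: "y \<in> carrier G" and hy: "\<And>i. i < n \<Longrightarrow> h y i = (if i < m then h x i else 0)"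
      using ex_coord[of "\<lambda>i. if i < m then h x i else 0"] by blast
    have "h x i = (if i < m then h x i else 0) + (if i = m then h x m else 0)" if "i < n" for i
      using Suc.prems(3)[of i] that by auto
    then have "x = y \<otimes> z (h x m)"
      using Suc.prems(2) y z hy hz by (intro coord_eqI) (auto simp: coord_mult)
    from arg_cong[OF this, of f] have "f x = f y + h x m * f (basis m)"
      using f[OF y z[of "h x m"]] fz[of "h x m"] z1 by simp
    moreover have "f y = (\<Sum>i<m. h y i * f (basis i))"
      using Suc.prems y hy by (intro Suc.IH) auto
    moreover have "\<dots> = (\<Sum>i<m. h x i * f (basis i))"
      using Suc.prems hy by (intro sum.cong) auto
    ultimately show ?case by simp
  qed
  from this[of n x] x show ?thesis by simp
qed

lemma additive_zeroI:
  fixes f :: "'a \<Rightarrow> int"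
  assumes "\<And>x y. x \<in> carrier G \<Longrightarrow> y \<in> carrier G \<Longrightarrow> f (x \<otimes> y) = f x + f y"
    and "\<And>i. i < n \<Longrightarrow> f (basis i) = 0" and "x \<in> carrier G"
  shows "f x = 0"
  using additive_expansion[of f x] assms by simp

end


section \<open>The trace form of a reduced order\<close>

locale order_basis = cring A for A (structure) +
  fixes n :: nat and h :: "'a \<Rightarrow> nat \<Rightarrow> int"
  assumes add_coord_iso: "h \<in> iso (add_monoid A) (product_group {..<n} (\<lambda>_. integer_group))"
begin

sublocale zb: z_basis "add_monoid A" n h
proof -
  interpret comm_group "add_monoid A" by (rule a_comm_group)
  show "z_basis (add_monoid A) n h"
    by unfold_locales (rule add_coord_iso)
qed

abbreviation b :: "nat \<Rightarrow> 'a" where "b \<equiv> zb.basis"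

lemma b_closed [simp]: "b i \<in> carrier A"
  using zb.basis_closed by simp

lemma coord_add: "x \<in> carrier A \<Longrightarrow> y \<in> carrier A \<Longrightarrow> i < n \<Longrightarrow> h (x \<oplus> y) i = h x i + h y i"
  using zb.coord_mult by simp

definition tr :: "'a \<Rightarrow> int" where
  "tr a = (\<Sum>i<n. h (a \<otimes> b i) i)"

lemma tr_add: "x \<in> carrier A \<Longrightarrow> y \<in> carrier A \<Longrightarrow> tr (x \<oplus> y) = tr x + tr y"
  by (simp add: tr_def l_distr coord_add sum.distrib)

text \<open>The regular representation, which turns nilpotency in \<open>A\<close> into nilpotency
  of a matrix.\<close>

definition mul_mat :: "'a \<Rightarrow> int mat" where
  "mul_mat a = mat n n (\<lambda>(i, j). h (a \<otimes> b j) i)"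

lemma mul_mat_carrier [simp]: "mul_mat a \<in> carrier_mat n n"
  by (simp add: mul_mat_def)

lemma coord_mult_left:
  assumes "a \<in> carrier A" "x \<in> carrier A" "i < n"
  shows "h (a \<otimes> x) i = (\<Sum>k<n. h x k * h (a \<otimes> b k) i)"
  using zb.additive_expansion[of "\<lambda>x. h (a \<otimes> x) i" x] assms by (simp add: r_distr coord_add)

lemma mul_mat_mult:
  assumes "x \<in> carrier A" "y \<in> carrier A"
  shows "mul_mat (x \<otimes> y) = mul_mat x * mul_mat y"
proof (rule eq_matI)
  fix i j assume "i < dim_row (mul_mat x * mul_mat y)" "j < dim_col (mul_mat x * mul_mat y)"
  then have ij: "i < n" "j < n" by (simp_all add: mul_mat_def)
  then show "mul_mat (x \<otimes> y) $$ (i, j) = (mul_mat x * mul_mat y) $$ (i, j)"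
    using assms coord_mult_left[of x "y \<otimes> b j" i]
    by (simp add: index_mult_mat_sum[of _ n] m_assoc mul_mat_def mult.commute del: index_mult_mat(1))
qed (simp_all add: mul_mat_def)

lemma mul_mat_one: "mul_mat \<one> = 1\<^sub>m n"
  by (rule eq_matI) (auto simp: mul_mat_def zb.coord_basis)

lemma mul_mat_pow: "x \<in> carrier A \<Longrightarrow> mul_mat (x [^] (k::nat)) = mul_mat x ^\<^sub>m k"
proof (induction k)
  case 0
  then show ?case by (simp add: mul_mat_one mul_mat_def[of x])
next
  case (Suc k)
  then show ?case by (simp add: mul_mat_mult)
qed

text \<open>Faithfulness of the regular representation: apply the matrix to the coordinates of the
  unit.\<close>

lemma mul_mat_eq_zeroD:
  assumes "x \<in> carrier A" "mul_mat x = 0\<^sub>m n n"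
  shows "x = \<zero>"
proof -
  have "h (x \<otimes> b j) i = 0" if "i < n" "j < n" for i j
    using arg_cong[OF assms(2), of "\<lambda>M. M $$ (i, j)"] that by (simp add: mul_mat_def)
  then have "h x i = 0" if "i < n" for i
    using coord_mult_left[of x \<one> i] assms that by simp
  moreover have "h \<zero> i = 0" if "i < n" for i
    using coord_add[of \<zero> \<zero> i] that by simp
  ultimately show ?thesis
    using zb.coord_eqI[of x \<zero>] assms by simp
qed

lemma tr_eq_mat_trace: "tr x = mat_trace (mul_mat x)"
  by (simp add: tr_def mat_trace_def mul_mat_def)

lemma trace_form_nondegenerate:
  assumes red: "\<And>x k. x \<in> carrier A \<Longrightarrow> x [^] (k::nat) = \<zero> \<Longrightarrow> x = \<zero>"
    and x: "x \<in> carrier A" and tr0: "\<And>a. a \<in> carrier A \<Longrightarrow> tr (a \<otimes> x) = 0"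
  shows "x = \<zero>"
proof -
  \<comment> \<open>Triangularisation needs an algebraically closed field, so the integer matrix is
    read over the complex numbers; injectivity of \<open>of_int\<close> brings the vanishing power
    back.\<close>
  define M where "M = map_mat (of_int :: int \<Rightarrow> complex) (mul_mat x)"
  have pow: "M ^\<^sub>m k = map_mat of_int (mul_mat (x [^] k))" for k
    by (simp add: M_def mul_mat_pow x of_int_hom.mat_hom_pow[OF mul_mat_carrier])
  have "mat_trace (M ^\<^sub>m k) = 0" if "k > 0" for k
  proof -
    have "mat_trace (M ^\<^sub>m k) = of_int (tr (x [^] k))"
      unfolding pow tr_eq_mat_trace by (simp add: mat_trace_def mul_mat_def)
    \<comment> \<open>The trace of a power is a value of the trace form: take
      \<open>a = x [^] (k - 1)\<close>, possible since \<open>k > 0\<close>.\<close>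
    also have "tr (x [^] k) = 0"
      using tr0[of "x [^] (k - 1)"] x that nat_pow_Suc[of x "k - 1"] by simp
    finally show ?thesis by simp
  qed
  then have "M ^\<^sub>m n = 0\<^sub>m n n"
    by (intro traces_zero_imp_nilpotent) (simp_all add: M_def)
  then have "map_mat (of_int :: int \<Rightarrow> complex) (mul_mat (x [^] n)) = map_mat of_int (0\<^sub>m n n)"
    unfolding pow by (auto intro!: eq_matI)
  then have "mul_mat (x [^] n) = 0\<^sub>m n n"
    by (rule of_int_hom.mat_hom_inj)
  then have "x [^] n = \<zero>"
    by (intro mul_mat_eq_zeroD) (simp_all add: x)
  with x show ?thesis by (rule red)
qed

text \<open>Cramer's rule without division. The Gram matrix \<open>g\<close> of the trace form has
  nonzero determinant, because a kernel vector would be the coordinate vector of an element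
  orthogonal to \<open>A\<close>. The coordinates \<open>adj_mat g *\<^sub>v w\<close> then solve
  the system up to the factor \<open>det g\<close>, the discriminant of \<open>A\<close>.\<close>

lemma trace_form_represents:
  fixes f :: "'a \<Rightarrow> int"
  assumes red: "\<And>x k. x \<in> carrier A \<Longrightarrow> x [^] (k::nat) = \<zero> \<Longrightarrow> x = \<zero>"
    and f: "\<And>x y. x \<in> carrier A \<Longrightarrow> y \<in> carrier A \<Longrightarrow> f (x \<oplus> y) = f x + f y"
  shows "\<exists>d z. d \<noteq> 0 \<and> z \<in> carrier A \<and> (\<forall>a\<in>carrier A. tr (a \<otimes> z) = d * f a)"
proof -
  define g where "g = mat n n (\<lambda>(i, j). tr (b i \<otimes> b j))"
  have g: "g \<in> carrier_mat n n" by (simp add: g_def)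
  have gv: "(g *\<^sub>v vec n (h x)) $ i = tr (b i \<otimes> x)" if "x \<in> carrier A" "i < n" for x i
    using zb.additive_expansion[of "\<lambda>x. tr (b i \<otimes> x)" x] that
    by (auto simp: g_def scalar_prod_def r_distr tr_add lessThan_atLeast0 mult.commute)
  \<comment> \<open>Both sides are additive in \<open>a\<close>, so a trace identity may be checked
    on the basis.\<close>
  have tr_ext: "tr (a \<otimes> x) = d * f' a"
    if "a \<in> carrier A" "x \<in> carrier A" "\<And>i. i < n \<Longrightarrow> tr (b i \<otimes> x) = d * f' (b i)"
      and "\<And>x y. x \<in> carrier A \<Longrightarrow> y \<in> carrier A \<Longrightarrow> f' (x \<oplus> y) = f' x + f' y" for a x d f'
    using zb.additive_zeroI[of "\<lambda>a. tr (a \<otimes> x) - d * f' a" a] that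
    by (simp add: l_distr tr_add algebra_simps)
  have "det g \<noteq> 0"
  proof
    assume "det g = 0"
    then obtain v where v: "v \<in> carrier_vec n" "v \<noteq> 0\<^sub>v n" "g *\<^sub>v v = 0\<^sub>v n"
      using det_0_iff_vec_prod_zero[OF g] by blast
    obtain x where x: "x \<in> carrier A" and hx: "\<And>i. i < n \<Longrightarrow> h x i = v $ i"
      using zb.ex_coord[of "\<lambda>i. v $ i"] by auto
    have vx: "v = vec n (h x)" using v(1) hx by auto
    have "tr (b i \<otimes> x) = 0" if "i < n" for i
      using gv[OF x that] v(3) that by (simp flip: vx)
    then have "tr (a \<otimes> x) = 0" if "a \<in> carrier A" for a
      using tr_ext[of a x 0 "\<lambda>_. 0"] that x by simp
    then have "x = \<zero>" using trace_form_nondegenerate red x by blast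
    moreover have "h \<zero> i = 0" if "i < n" for i
      using coord_add[of \<zero> \<zero> i] that by simp
    ultimately have "v = 0\<^sub>v n" using vx by auto
    with v(2) show False ..
  qed
  define w where "w = vec n (\<lambda>i. f (b i))"
  obtain z where z: "z \<in> carrier A" and hz: "\<And>i. i < n \<Longrightarrow> h z i = (adj_mat g *\<^sub>v w) $ i"
    using zb.ex_coord[of "\<lambda>i. (adj_mat g *\<^sub>v w) $ i"] by auto
  have zw: "vec n (h z) = adj_mat g *\<^sub>v w"
    using hz adj_mat(1)[OF g] by auto
  have "tr (b i \<otimes> z) = det g * f (b i)" if "i < n" for i
  proof -
    have "tr (b i \<otimes> z) = (g *\<^sub>v (adj_mat g *\<^sub>v w)) $ i"
      using gv[OF z that] zw by simp
    also have "g *\<^sub>v (adj_mat g *\<^sub>v w) = (g * adj_mat g) *\<^sub>v w"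
      using adj_mat(1)[OF g] g by (intro assoc_mult_mat_vec[symmetric, of _ n n _ n]) (auto simp: w_def)
    also have "\<dots> = det g \<cdot>\<^sub>v w"
      unfolding adj_mat(2)[OF g] by (intro eq_vecI) (auto simp: w_def)
    finally show ?thesis using that by (simp add: w_def)
  qed
  then have "\<forall>a\<in>carrier A. tr (a \<otimes> z) = det g * f a"
    using tr_ext[of _ z "det g" f] z f by blast
  with \<open>det g \<noteq> 0\<close> z show ?thesis by blast
qed

end

section \<open>Tensor products\<close>

text \<open>Linearity in the extended function rather than in the argument; it yields linearity of
  \<open>bil\<close> in its second argument.\<close>

lemma frag_extend_fun_diff:
  "frag_extend (\<lambda>x. f x - g x) c = frag_extend f c - frag_extend g c"
  using subset_UNIV by (induction c rule: frag_induction) (auto simp: frag_extend_diff)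

context abelian_group
begin

lemma add_minus_minus:
  assumes "a \<in> carrier G" "b \<in> carrier G"
  shows "a \<oplus> b \<ominus> a \<ominus> b = \<zero>"
proof -
  have "a \<oplus> b \<ominus> a \<ominus> b = (a \<oplus> b) \<oplus> (\<ominus> a \<oplus> \<ominus> b)"
    using assms by (simp add: minus_eq a_assoc)
  also have "\<dots> = (a \<oplus> b) \<oplus> \<ominus> (a \<oplus> b)"
    using assms by (simp add: minus_add)
  finally show ?thesis using assms by (simp add: r_neg)
qed

lemma minus_eq_zeroD:
  assumes "a \<in> carrier G" "b \<in> carrier G" "a \<ominus> b = \<zero>"
  shows "a = b"
proof -
  have "a = a \<ominus> b \<oplus> b" using assms(1,2) by (simp add: minus_eq a_assoc l_neg)
  with assms show ?thesis by simp
qed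

lemma add_pow_int_closed: "x \<in> carrier G \<Longrightarrow> add_pow G (k::int) x \<in> carrier G"
  unfolding add_pow_def using group.int_pow_closed[OF a_group] by simp

lemma add_pow_int_add:
  "x \<in> carrier G \<Longrightarrow> add_pow G (k + l :: int) x = add_pow G k x \<oplus> add_pow G l x"
  unfolding add_pow_def using group.int_pow_mult[OF a_group] by simp

lemma add_pow_int_0: "add_pow G (0::int) x = \<zero>"
  unfolding add_pow_def by (simp add: int_pow_def2)

lemma add_pow_int_1: "x \<in> carrier G \<Longrightarrow> add_pow G (1::int) x = x"
  unfolding add_pow_def using group.int_pow_1[OF a_group] by simp

end

lemma tensor_one: "\<one>\<^bsub>tensor R M N\<^esub> = pure_tensor R M N \<one>\<^bsub>M\<^esub> \<one>\<^bsub>N\<^esub>"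
  by (simp add: tensor_def Let_def)

text \<open>Closure under scalars places the relations in the free group. Module axioms enter with
  the action on the left factor, in \<open>tensor_module\<close>.\<close>

locale tensor_pair = M: abelian_group M + N: abelian_group N
  for R :: "('r, 'x) ring_scheme" and M :: "('r, 'm, 'p) module_scheme"
    and N :: "('r, 'n, 'q) module_scheme" +
  assumes smult_closed_M: "r \<in> carrier R \<Longrightarrow> x \<in> carrier M \<Longrightarrow> r \<odot>\<^bsub>M\<^esub> x \<in> carrier M"
    and smult_closed_N: "r \<in> carrier R \<Longrightarrow> y \<in> carrier N \<Longrightarrow> r \<odot>\<^bsub>N\<^esub> y \<in> carrier N"
begin

abbreviation "F \<equiv> tensor_free M N"
abbreviation "K \<equiv> tensor_ker R M N"
abbreviation "T \<equiv> tensor R M N"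
abbreviation "pure \<equiv> pure_tensor R M N"

definition coset :: "('m \<times> 'n \<Rightarrow>\<^sub>0 int) \<Rightarrow> ('m \<times> 'n \<Rightarrow>\<^sub>0 int) set" where
  "coset c = K #>\<^bsub>F\<^esub> c"

lemma F_simps [simp]:
  "c \<in> carrier F \<longleftrightarrow> Poly_Mapping.keys c \<subseteq> carrier M \<times> carrier N"
  "monoid.mult F c d = c + d" "one F = 0"
  by (simp_all add: tensor_free_def)

lemma F_group: "comm_group F"
  unfolding tensor_free_def by (rule abelian_free_Abelian_group)

interpretation F: comm_group F by (rule F_group)

lemma F_inv [simp]: "c \<in> carrier F \<Longrightarrow> inv\<^bsub>F\<^esub> c = - c"
  by (simp add: tensor_free_def)

lemma F_add_closed: "c \<in> carrier F \<Longrightarrow> d \<in> carrier F \<Longrightarrow> c + d \<in> carrier F"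
  using F.m_closed[of c d] by simp

lemma F_uminus_closed: "c \<in> carrier F \<Longrightarrow> - c \<in> carrier F"
  by simp

lemma F_diff_closed: "c \<in> carrier F \<Longrightarrow> d \<in> carrier F \<Longrightarrow> c - d \<in> carrier F"
  using F_add_closed[of c "- d"] by simp

lemma frag_of_F: "x \<in> carrier M \<Longrightarrow> y \<in> carrier N \<Longrightarrow> frag_of (x, y) \<in> carrier F"
  by simp

lemma rels_cases [consumes 1, case_names add_left add_right balanced]:
  assumes "c \<in> tensor_rels R M N"
  obtains x x' y where "c = frag_of (x \<oplus>\<^bsub>M\<^esub> x', y) - frag_of (x, y) - frag_of (x', y)"
      "x \<in> carrier M" "x' \<in> carrier M" "y \<in> carrier N"
    | x y y' where "c = frag_of (x, y \<oplus>\<^bsub>N\<^esub> y') - frag_of (x, y) - frag_of (x, y')"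
      "x \<in> carrier M" "y \<in> carrier N" "y' \<in> carrier N"
    | r x y where "c = frag_of (r \<odot>\<^bsub>M\<^esub> x, y) - frag_of (x, r \<odot>\<^bsub>N\<^esub> y)"
      "r \<in> carrier R" "x \<in> carrier M" "y \<in> carrier N"
  using assms unfolding tensor_rels_def
  by (elim UnE CollectE exE conjE)
    (rule that(1), assumption+ | rule that(2), assumption+ | rule that(3), assumption+)+

lemma rels_in_F: "c \<in> tensor_rels R M N \<Longrightarrow> c \<in> carrier F"
  by (cases rule: rels_cases)
    (auto intro!: F_diff_closed frag_of_F smult_closed_M smult_closed_N simp del: F_simps(1))

lemma K_subgroup: "subgroup K F"
  unfolding tensor_ker_def by (rule F.generate_is_subgroup) (rule subsetI, erule rels_in_F)

interpretation K: normal K F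
  by (rule F.subgroup_imp_normal[OF K_subgroup])

lemma K_zero: "0 \<in> K" and K_in_F: "k \<in> K \<Longrightarrow> k \<in> carrier F"
  and K_add: "k \<in> K \<Longrightarrow> k' \<in> K \<Longrightarrow> k + k' \<in> K"
  and K_uminus: "k \<in> K \<Longrightarrow> - k \<in> K"
proof -
  show "0 \<in> K" using K.one_closed by simp
  show k: "k \<in> K \<Longrightarrow> k \<in> carrier F" by (rule K.mem_carrier)
  show "k \<in> K \<Longrightarrow> k' \<in> K \<Longrightarrow> k + k' \<in> K" using K.m_closed[of k k'] by simp
  show "k \<in> K \<Longrightarrow> - k \<in> K" using K.m_inv_closed[of k] F_inv[OF k] by simp
qed

lemma K_diff: "k \<in> K \<Longrightarrow> k' \<in> K \<Longrightarrow> k - k' \<in> K"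
  using K_add[of k "- k'"] K_uminus[of k'] by simp

lemma rels_in_K: "c \<in> tensor_rels R M N \<Longrightarrow> c \<in> K"
  unfolding tensor_ker_def by (rule generate.incl)

lemma mem_coset: "d \<in> coset c \<longleftrightarrow> d - c \<in> K"
proof -
  have "d \<in> coset c \<longleftrightarrow> (\<exists>k\<in>K. d = k + c)"
    by (auto simp: coset_def r_coset_def)
  also have "\<dots> \<longleftrightarrow> d - c \<in> K"
    by (metis add_diff_cancel_right' diff_add_cancel)
  finally show ?thesis .
qed

lemma coset_eq_iff: "coset c = coset d \<longleftrightarrow> c - d \<in> K"
proof
  have "c \<in> coset c" by (simp add: mem_coset K_zero)
  moreover assume "coset c = coset d"
  ultimately show "c - d \<in> K" by (simp add: mem_coset)
next
  assume cd: "c - d \<in> K"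
  then have "x - c \<in> K \<longleftrightarrow> x - d \<in> K" for x
    using K_add[OF _ cd, of "x - c"] K_diff[OF _ cd, of "x - d"] by auto
  then show "coset c = coset d"
    by (auto simp: mem_coset)
qed

lemma tensor_sel:
  "carrier T = coset ` carrier F" "\<zero>\<^bsub>T\<^esub> = coset 0"
  "c \<in> carrier F \<Longrightarrow> d \<in> carrier F \<Longrightarrow> coset c \<oplus>\<^bsub>T\<^esub> coset d = coset (c + d)"
proof -
  show "carrier T = coset ` carrier F"
    by (auto simp: tensor_def Let_def FactGroup_def RCOSETS_def coset_def)
  show "\<zero>\<^bsub>T\<^esub> = coset 0"
    by (auto simp: tensor_def Let_def mem_coset)
  show "c \<in> carrier F \<Longrightarrow> d \<in> carrier F \<Longrightarrow> coset c \<oplus>\<^bsub>T\<^esub> coset d = coset (c + d)"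
    using K.rcos_sum[of c d] by (simp add: tensor_def Let_def coset_def)
qed

lemma pure_eq_coset: "pure x y = coset (frag_of (x, y))"
  by (simp add: pure_tensor_def coset_def)

lemma coset_closed: "c \<in> carrier F \<Longrightarrow> coset c \<in> carrier T"
  unfolding tensor_sel by (rule imageI)

lemma pure_closed: "x \<in> carrier M \<Longrightarrow> y \<in> carrier N \<Longrightarrow> pure x y \<in> carrier T"
  unfolding pure_eq_coset by (intro coset_closed frag_of_F)

lemma T_abelian_group: "abelian_group T"
proof (rule abelian_groupI)
  fix s t u assume "s \<in> carrier T" "t \<in> carrier T" "u \<in> carrier T"
  then obtain c d e where c: "c \<in> carrier F" "s = coset c" and d: "d \<in> carrier F" "t = coset d"
    and e: "e \<in> carrier F" "u = coset e"
    unfolding tensor_sel by blast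
  show "s \<oplus>\<^bsub>T\<^esub> t \<in> carrier T"
    using c d by (simp add: tensor_sel(3) del: F_simps(1)) (intro coset_closed F_add_closed)
  show "s \<oplus>\<^bsub>T\<^esub> t \<oplus>\<^bsub>T\<^esub> u = s \<oplus>\<^bsub>T\<^esub> (t \<oplus>\<^bsub>T\<^esub> u)"
    using c d e F_add_closed by (simp add: tensor_sel(3) add.assoc del: F_simps(1))
  show "s \<oplus>\<^bsub>T\<^esub> t = t \<oplus>\<^bsub>T\<^esub> s"
    using c d by (simp add: tensor_sel(3) add.commute del: F_simps(1))
next
  show "\<zero>\<^bsub>T\<^esub> \<in> carrier T"
    unfolding tensor_sel(2) by (rule coset_closed) simp
next
  fix s assume "s \<in> carrier T"
  then obtain c where c: "c \<in> carrier F" "s = coset c"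
    unfolding tensor_sel by blast
  have z: "0 \<in> carrier F" by simp
  show "\<zero>\<^bsub>T\<^esub> \<oplus>\<^bsub>T\<^esub> s = s"
    using c z by (simp add: tensor_sel(2,3) del: F_simps(1))
  have "coset (- c) \<oplus>\<^bsub>T\<^esub> s = \<zero>\<^bsub>T\<^esub>"
    using c F_uminus_closed by (simp add: tensor_sel(2,3) del: F_simps(1))
  then show "\<exists>t\<in>carrier T. t \<oplus>\<^bsub>T\<^esub> s = \<zero>\<^bsub>T\<^esub>"
    using c coset_closed F_uminus_closed by blast
qed

interpretation T: abelian_group T by (rule T_abelian_group)

lemma pure_add_left:
  assumes "x \<in> carrier M" "x' \<in> carrier M" "y \<in> carrier N"
  shows "pure (x \<oplus>\<^bsub>M\<^esub> x') y = pure x y \<oplus>\<^bsub>T\<^esub> pure x' y"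
proof -
  have "frag_of (x \<oplus>\<^bsub>M\<^esub> x', y) - frag_of (x, y) - frag_of (x', y) \<in> K"
    using assms by (intro rels_in_K) (auto simp: tensor_rels_def)
  then show ?thesis
    using assms by (simp add: pure_eq_coset tensor_sel(3) coset_eq_iff diff_diff_eq)
qed

lemma pure_balanced:
  assumes "r \<in> carrier R" "x \<in> carrier M" "y \<in> carrier N"
  shows "pure (r \<odot>\<^bsub>M\<^esub> x) y = pure x (r \<odot>\<^bsub>N\<^esub> y)"
proof -
  have "frag_of (r \<odot>\<^bsub>M\<^esub> x, y) - frag_of (x, r \<odot>\<^bsub>N\<^esub> y) \<in> K"
    using assms by (intro rels_in_K) (auto simp: tensor_rels_def)
  then show ?thesis
    by (simp add: pure_eq_coset coset_eq_iff)
qed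

lemma pure_zero_left:
  assumes "y \<in> carrier N"
  shows "pure \<zero>\<^bsub>M\<^esub> y = \<zero>\<^bsub>T\<^esub>"
  using pure_add_left[of "\<zero>\<^bsub>M\<^esub>" "\<zero>\<^bsub>M\<^esub>" y] pure_closed[of "\<zero>\<^bsub>M\<^esub>" y] assms by simp

text \<open>Minus a pure tensor is the pure tensor with negated left factor, so sums of pure tensors
  exhaust the tensor product and no case for negatives arises.\<close>

lemma tensor_induct [consumes 1, case_names zero pure add]:
  assumes t: "t \<in> carrier T"
    and P_zero: "P \<zero>\<^bsub>T\<^esub>"
    and P_pure: "\<And>x y. x \<in> carrier M \<Longrightarrow> y \<in> carrier N \<Longrightarrow> P (pure x y)"
    and P_add: "\<And>s t. s \<in> carrier T \<Longrightarrow> t \<in> carrier T \<Longrightarrow> P s \<Longrightarrow> P t \<Longrightarrow> P (s \<oplus>\<^bsub>T\<^esub> t)"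
  shows "P t"
proof -
  obtain c where c: "c \<in> carrier F" "t = coset c"
    using t unfolding tensor_sel by blast
  have "Poly_Mapping.keys c \<subseteq> carrier M \<times> carrier N"
    using c by simp
  \<comment> \<open>The induction on the free group goes by differences, hence the claim is carried
    for \<open>- c\<close> as well.\<close>
  then have "P (coset c) \<and> P (coset (- c))"
  proof (induction c rule: free_Abelian_group_induct[consumes 1, case_names zero diff one])
    case zero
    then show ?case using P_zero unfolding tensor_sel(2) by simp
  next
    case (diff c d)
    then have F: "c \<in> carrier F" "d \<in> carrier F" "- c \<in> carrier F" "- d \<in> carrier F"
      by simp_all
    show ?case
      using P_add[OF coset_closed coset_closed, of c "- d"] P_add[OF coset_closed coset_closed, of "- c" d] F diff
      by (simp add: tensor_sel(3))
  next
    case (one p)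
    then obtain x y where p: "p = (x, y)" "x \<in> carrier M" "y \<in> carrier N" by blast
    have "pure (\<ominus>\<^bsub>M\<^esub> x) y \<oplus>\<^bsub>T\<^esub> pure x y = \<zero>\<^bsub>T\<^esub>"
      using p by (simp add: pure_add_left[symmetric] pure_zero_left M.l_neg)
    then have "frag_of (\<ominus>\<^bsub>M\<^esub> x, y) + frag_of (x, y) \<in> K"
      using p by (simp add: pure_eq_coset tensor_sel(2,3) coset_eq_iff)
    from K_uminus[OF this] have "coset (- frag_of p) = pure (\<ominus>\<^bsub>M\<^esub> x) y"
      by (simp add: pure_eq_coset coset_eq_iff p(1) algebra_simps)
    then show ?case
      using P_pure[of x y] P_pure[of "\<ominus>\<^bsub>M\<^esub> x" y] p by (simp add: pure_eq_coset)
  qed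
  with c show ?thesis by simp
qed

text \<open>An additive map on the free group descends to the quotient once it sends the defining
  relations into \<open>K\<close>. It serves both the scalar action and the product.\<close>

lemma frag_extend_ker:
  assumes "\<And>c. c \<in> tensor_rels R M N \<Longrightarrow> frag_extend g c \<in> K" and "k \<in> K"
  shows "frag_extend g k \<in> K"
  using \<open>k \<in> K\<close> unfolding tensor_ker_def
proof (induction k rule: generate.induct)
  case one
  then show ?case by (simp flip: tensor_ker_def add: K_zero)
next
  case (incl c)
  then show ?case using assms(1) by (simp flip: tensor_ker_def)
next
  case (inv c)
  then have "inv\<^bsub>F\<^esub> c = - c" using rels_in_F by (intro F_inv) auto
  then show ?case
    using assms(1)[OF inv] K_uminus by (simp flip: tensor_ker_def add: frag_extend_minus)
next
  case (eng c d)
  then show ?case using K_add by (simp flip: tensor_ker_def add: frag_extend_add)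
qed

text \<open>The operations of \<open>tensor\<close> collect the results over all representatives and
  multiply by \<open>K\<close>. If these results agree modulo \<open>K\<close>, any one of them
  names the class.\<close>

lemma set_mult_coset:
  assumes "c \<in> S" and "\<And>d. d \<in> S \<Longrightarrow> d - c \<in> K"
  shows "K <#>\<^bsub>F\<^esub> S = coset c"
proof
  show "K <#>\<^bsub>F\<^esub> S \<subseteq> coset c"
  proof
    fix u assume "u \<in> K <#>\<^bsub>F\<^esub> S"
    then obtain k d where "k \<in> K" "d \<in> S" "u = k + d"
      by (auto simp: set_mult_def)
    then show "u \<in> coset c"
      using K_add[OF _ assms(2), of k d] by (simp add: mem_coset add_diff_eq)
  qed
  show "coset c \<subseteq> K <#>\<^bsub>F\<^esub> S"
  proof
    fix u assume "u \<in> coset c"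
    then have "u - c \<in> K" by (simp add: mem_coset)
    moreover have "u = (u - c) \<otimes>\<^bsub>F\<^esub> c" by simp
    ultimately show "u \<in> K <#>\<^bsub>F\<^esub> S"
      using assms(1) unfolding set_mult_def by blast
  qed
qed

end


section \<open>Additive maps out of a tensor product\<close>

locale tensor_balanced = tensor_pair R M N + P: abelian_group P
  for R :: "('r, 'x) ring_scheme" and M :: "('r, 'm, 'p) module_scheme"
    and N :: "('r, 'n, 'q) module_scheme" and P :: "('c, 'k) ring_scheme" +
  fixes f :: "'m \<Rightarrow> 'n \<Rightarrow> 'c"
  assumes f_closed: "x \<in> carrier M \<Longrightarrow> y \<in> carrier N \<Longrightarrow> f x y \<in> carrier P"
    and f_add_left: "x \<in> carrier M \<Longrightarrow> x' \<in> carrier M \<Longrightarrow> y \<in> carrier N \<Longrightarrow>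
      f (x \<oplus>\<^bsub>M\<^esub> x') y = f x y \<oplus>\<^bsub>P\<^esub> f x' y"
    and f_add_right: "x \<in> carrier M \<Longrightarrow> y \<in> carrier N \<Longrightarrow> y' \<in> carrier N \<Longrightarrow>
      f x (y \<oplus>\<^bsub>N\<^esub> y') = f x y \<oplus>\<^bsub>P\<^esub> f x y'"
    and f_balanced: "r \<in> carrier R \<Longrightarrow> x \<in> carrier M \<Longrightarrow> y \<in> carrier N \<Longrightarrow>
      f (r \<odot>\<^bsub>M\<^esub> x) y = f x (r \<odot>\<^bsub>N\<^esub> y)"
begin

text \<open>The sum inside \<open>tensor_lift\<close>, taken at one representative.\<close>

definition ext :: "('m \<times> 'n \<Rightarrow>\<^sub>0 int) \<Rightarrow> 'c" where
  "ext c = (\<Oplus>\<^bsub>P\<^esub>p \<in> Poly_Mapping.keys c. add_pow P (Poly_Mapping.lookup c p) (f (fst p) (snd p)))"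

text \<open>Gives the sums for \<open>c\<close>, \<open>d\<close> and \<open>c + d\<close> a common
  index set, the extra terms having coefficient 0.\<close>

lemma ext_superset:
  assumes "finite S" "Poly_Mapping.keys c \<subseteq> S" "S \<subseteq> carrier M \<times> carrier N"
  shows "ext c = (\<Oplus>\<^bsub>P\<^esub>p \<in> S. add_pow P (Poly_Mapping.lookup c p) (f (fst p) (snd p)))"
  unfolding ext_def using assms f_closed
  by (intro P.add.finprod_mono_neutral_cong_left) (auto simp: in_keys_iff P.add_pow_int_0 intro!: P.add_pow_int_closed)

lemma ext_closed: "c \<in> carrier F \<Longrightarrow> ext c \<in> carrier P"
  unfolding ext_def using f_closed by (intro P.finsum_closed) (auto intro!: P.add_pow_int_closed)

lemma ext_add:
  assumes "c \<in> carrier F" "d \<in> carrier F"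
  shows "ext (c + d) = ext c \<oplus>\<^bsub>P\<^esub> ext d"
proof -
  define S where "S = Poly_Mapping.keys c \<union> Poly_Mapping.keys d"
  have S: "finite S" "S \<subseteq> carrier M \<times> carrier N"
    using assms by (auto simp: S_def)
  have fS: "f (fst p) (snd p) \<in> carrier P" if "p \<in> S" for p
    using subsetD[OF S(2) that] by (simp add: mem_Times_iff f_closed)
  then have clo: "(\<lambda>p. add_pow P (Poly_Mapping.lookup e p) (f (fst p) (snd p))) \<in> S \<rightarrow> carrier P"
    for e :: "'m \<times> 'n \<Rightarrow>\<^sub>0 int"
    by (intro Pi_I P.add_pow_int_closed)
  have "ext (c + d) = (\<Oplus>\<^bsub>P\<^esub>p \<in> S. add_pow P (Poly_Mapping.lookup (c + d) p) (f (fst p) (snd p)))"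
    using S keys_add[of c d] by (intro ext_superset) (auto simp: S_def)
  also have "\<dots> = (\<Oplus>\<^bsub>P\<^esub>p \<in> S. add_pow P (Poly_Mapping.lookup c p) (f (fst p) (snd p))
      \<oplus>\<^bsub>P\<^esub> add_pow P (Poly_Mapping.lookup d p) (f (fst p) (snd p)))"
    by (intro P.add.finprod_cong')
      (auto simp: lookup_add P.add_pow_int_add P.add_pow_int_closed fS)
  also have "\<dots> = ext c \<oplus>\<^bsub>P\<^esub> ext d"
    using S clo ext_superset[of S c] ext_superset[of S d]
    by (simp add: P.finsum_addf del: Un_subset_iff) (simp add: S_def)
  finally show ?thesis .
qed

lemma ext_frag_of: "x \<in> carrier M \<Longrightarrow> y \<in> carrier N \<Longrightarrow> ext (frag_of (x, y)) = f x y"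
  using f_closed by (simp add: ext_def P.add_pow_int_1)

lemma ext_hom: "group_hom F (add_monoid P) ext"
proof -
  interpret F: comm_group F by (rule F_group)
  show ?thesis
    by unfold_locales (auto simp: hom_def ext_add ext_closed simp del: F_simps(1))
qed

lemma ext_diff:
  assumes "c \<in> carrier F" "d \<in> carrier F"
  shows "ext (c - d) = ext c \<ominus>\<^bsub>P\<^esub> ext d"
proof -
  interpret e: group_hom F "add_monoid P" ext by (rule ext_hom)
  have "ext (- d) = \<ominus>\<^bsub>P\<^esub> ext d"
    using e.hom_inv[OF assms(2)] F_inv[OF assms(2)] by (simp add: a_inv_def)
  then show ?thesis
    using ext_add[OF assms(1) F_uminus_closed[OF assms(2)]] by (simp add: P.minus_eq)
qed

text \<open>The kernel of \<open>ext\<close> is a subgroup, so it is enough that it contains the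
  relations.\<close>

lemma ext_ker: "k \<in> K \<Longrightarrow> ext k = \<zero>\<^bsub>P\<^esub>"
proof -
  interpret e: group_hom F "add_monoid P" ext by (rule ext_hom)
  have "ext c = \<zero>\<^bsub>P\<^esub>" if "c \<in> tensor_rels R M N" for c
    using that
  proof (cases rule: rels_cases)
    case (add_left x x' y)
    then show ?thesis
      using f_closed
      by (simp add: ext_diff F_diff_closed frag_of_F ext_frag_of f_add_left P.add_minus_minus del: F_simps(1))
  next
    case (add_right x y y')
    then show ?thesis
      using f_closed
      by (simp add: ext_diff F_diff_closed frag_of_F ext_frag_of f_add_right P.add_minus_minus del: F_simps(1))
  next
    case (balanced r x y)
    then show ?thesis
      using f_closed smult_closed_M smult_closed_N
      by (simp add: ext_diff ext_frag_of f_balanced P.r_neg P.minus_eq)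
  qed
  then have "tensor_rels R M N \<subseteq> kernel F (add_monoid P) ext"
    using rels_in_F by (auto simp: kernel_def)
  then have "K \<subseteq> kernel F (add_monoid P) ext"
    unfolding tensor_ker_def by (intro e.generate_subgroup_incl e.subgroup_kernel)
  then show "k \<in> K \<Longrightarrow> ext k = \<zero>\<^bsub>P\<^esub>"
    by (auto simp: kernel_def)
qed

text \<open>This justifies \<open>the_elem\<close>: two representatives differ by an element of
  \<open>K\<close>, where \<open>ext\<close> vanishes.\<close>

lemma tensor_lift_coset:
  assumes "c \<in> carrier F"
  shows "tensor_lift P f (coset c) = ext c"
proof -
  have "ext d = ext c" if "d \<in> coset c" for d
  proof -
    have dc: "d - c \<in> K" using that by (simp add: mem_coset)
    from ext_add[OF K_in_F[OF dc] assms] ext_ker[OF dc] assms ext_closed show ?thesis by simp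
  qed
  moreover have "c \<in> coset c" by (simp add: mem_coset K_zero)
  ultimately have "ext ` coset c = {ext c}" by blast
  then show ?thesis
    by (simp add: tensor_lift_def flip: ext_def)
qed

lemma tensor_lift_pure:
  "x \<in> carrier M \<Longrightarrow> y \<in> carrier N \<Longrightarrow> tensor_lift P f (pure x y) = f x y"
  unfolding pure_eq_coset by (simp add: tensor_lift_coset ext_frag_of)

lemma tensor_lift_zero: "tensor_lift P f \<zero>\<^bsub>T\<^esub> = \<zero>\<^bsub>P\<^esub>"
  using tensor_lift_coset[of 0] ext_ker[OF K_zero] by (simp add: tensor_sel(2))

end


section \<open>The scalar action on a tensor product\<close>

locale tensor_module = tensor_pair R M N + M: module R M
  for R :: "('r, 'x) ring_scheme" and M :: "('r, 'm, 'p) module_scheme"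
    and N :: "('r, 'n, 'q) module_scheme"
begin

definition act :: "'r \<Rightarrow> ('m \<times> 'n \<Rightarrow>\<^sub>0 int) \<Rightarrow> ('m \<times> 'n \<Rightarrow>\<^sub>0 int)" where
  "act r = frag_extend (\<lambda>(x, y). frag_of (r \<odot>\<^bsub>M\<^esub> x, y))"

lemma act_ker:
  assumes r: "r \<in> carrier R" and "k \<in> K"
  shows "act r k \<in> K"
  unfolding act_def using _ \<open>k \<in> K\<close>
proof (rule frag_extend_ker)
  fix c assume "c \<in> tensor_rels R M N"
  then show "frag_extend (\<lambda>(x, y). frag_of (r \<odot>\<^bsub>M\<^esub> x, y)) c \<in> K"
  proof (cases rule: rels_cases)
    case (add_left x x' y)
    then show ?thesis
      using r by (intro rels_in_K)
        (auto simp: frag_extend_diff tensor_rels_def M.smult_r_distr smult_closed_M)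
  next
    case (add_right x y y')
    then show ?thesis
      using r by (intro rels_in_K) (auto simp: frag_extend_diff tensor_rels_def smult_closed_M)
  next
    case (balanced s x y)
    \<comment> \<open>Commutativity of the scalars turns the image of a balancing relation into a
      balancing relation again.\<close>
    then have "r \<odot>\<^bsub>M\<^esub> (s \<odot>\<^bsub>M\<^esub> x) = s \<odot>\<^bsub>M\<^esub> (r \<odot>\<^bsub>M\<^esub> x)"
      using r by (simp flip: M.smult_assoc1 add: M.R.m_comm)
    then show ?thesis
      using r balanced by (intro rels_in_K) (auto simp: frag_extend_diff tensor_rels_def smult_closed_M)
  qed
qed

lemma smult_coset:
  assumes "r \<in> carrier R" "c \<in> carrier F"
  shows "r \<odot>\<^bsub>T\<^esub> coset c = coset (act r c)"
proof -
  have "K <#>\<^bsub>F\<^esub> (act r ` coset c) = coset (act r c)"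
  proof (rule set_mult_coset)
    show "act r c \<in> act r ` coset c" by (simp add: mem_coset K_zero)
    fix d assume "d \<in> act r ` coset c"
    then obtain e where "d = act r e" "e - c \<in> K" by (auto simp: mem_coset)
    then show "d - act r c \<in> K"
      using act_ker[OF assms(1), of "e - c"] by (simp add: act_def frag_extend_diff)
  qed
  then show ?thesis
    by (simp add: tensor_def Let_def act_def)
qed

lemma smult_pure:
  "r \<in> carrier R \<Longrightarrow> x \<in> carrier M \<Longrightarrow> y \<in> carrier N \<Longrightarrow> r \<odot>\<^bsub>T\<^esub> pure x y = pure (r \<odot>\<^bsub>M\<^esub> x) y"
  unfolding pure_eq_coset by (simp add: smult_coset act_def)

end


section \<open>The product on a tensor product of commutative algebras\<close>

locale tensor_algebra = tensor_pair R M N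
  for R :: "('r, 'x) ring_scheme" and M :: "('r, 'm, 'p) module_scheme"
    and N :: "('r, 'n, 'q) module_scheme" +
  assumes M_cring: "cring M" and N_cring: "cring N"
    and M_smult: "r \<in> carrier R \<Longrightarrow> x \<in> carrier M \<Longrightarrow> x' \<in> carrier M \<Longrightarrow>
      r \<odot>\<^bsub>M\<^esub> (x \<otimes>\<^bsub>M\<^esub> x') = (r \<odot>\<^bsub>M\<^esub> x) \<otimes>\<^bsub>M\<^esub> x'"
    and N_smult: "r \<in> carrier R \<Longrightarrow> y \<in> carrier N \<Longrightarrow> y' \<in> carrier N \<Longrightarrow>
      r \<odot>\<^bsub>N\<^esub> (y \<otimes>\<^bsub>N\<^esub> y') = (r \<odot>\<^bsub>N\<^esub> y) \<otimes>\<^bsub>N\<^esub> y'"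
begin

interpretation M: cring M by (rule M_cring)
interpretation N: cring N by (rule N_cring)

definition pm :: "'m \<times> 'n \<Rightarrow> 'm \<times> 'n \<Rightarrow> ('m \<times> 'n \<Rightarrow>\<^sub>0 int)" where
  "pm = (\<lambda>(x, y) (x', y'). frag_of (x \<otimes>\<^bsub>M\<^esub> x', y \<otimes>\<^bsub>N\<^esub> y'))"

lemma pm_commute:
  "p \<in> carrier M \<times> carrier N \<Longrightarrow> q \<in> carrier M \<times> carrier N \<Longrightarrow> pm p q = pm q p"
  by (auto simp: pm_def M.m_comm N.m_comm)

definition bil :: "('m \<times> 'n \<Rightarrow>\<^sub>0 int) \<Rightarrow> ('m \<times> 'n \<Rightarrow>\<^sub>0 int) \<Rightarrow> ('m \<times> 'n \<Rightarrow>\<^sub>0 int)" where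
  "bil u v = frag_extend (\<lambda>p. frag_extend (pm p) v) u"

lemma bil_diff_left: "bil (u - u') v = bil u v - bil u' v"
  by (simp add: bil_def frag_extend_diff)

lemma bil_diff_right: "bil u (v - v') = bil u v - bil u v'"
  by (simp add: bil_def frag_extend_diff frag_extend_fun_diff)

lemma bil_frag_of: "bil (frag_of p) (frag_of q) = pm p q"
  by (simp add: bil_def)

text \<open>Carries \<open>bil_ker_left\<close> over to the right argument.\<close>

lemma bil_commute:
  assumes "u \<in> carrier F" "v \<in> carrier F"
  shows "bil u v = bil v u"
proof -
  have *: "bil u (frag_of q) = bil (frag_of q) u" if "q \<in> carrier M \<times> carrier N" for q
    using assms(1)[unfolded F_simps]
  proof (induction u rule: frag_induction)
    case (one p)
    then show ?case using pm_commute that by (auto simp: bil_frag_of)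
  next
    case (diff a b)
    then show ?case by (simp add: bil_diff_left bil_diff_right)
  qed (simp add: bil_def)
  show ?thesis
    using assms(2)[unfolded F_simps]
  proof (induction v rule: frag_induction)
    case zero
    then show ?case by (simp add: bil_def frag_extend_eq_0)
  next
    case (diff a b)
    then show ?case by (simp add: bil_diff_left bil_diff_right)
  qed (use * in auto)
qed

text \<open>Multiplication by a generator maps each relation to a relation of the same kind;
  additivity in \<open>v\<close> does the rest.\<close>

lemma bil_ker_left:
  assumes "k \<in> K" "v \<in> carrier F"
  shows "bil k v \<in> K"
  using assms(2)[unfolded F_simps]
proof (induction v rule: frag_induction)
  case zero
  then show ?case by (simp add: bil_def frag_extend_eq_0 K_zero)
next
  case (one q)
  then obtain x' y' where q: "q = (x', y')" "x' \<in> carrier M" "y' \<in> carrier N" by blast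
  show ?case
    unfolding bil_def using _ \<open>k \<in> K\<close>
  proof (rule frag_extend_ker)
    fix c assume "c \<in> tensor_rels R M N"
    then have "frag_extend (\<lambda>p. frag_extend (pm p) (frag_of q)) c \<in> tensor_rels R M N"
    proof (cases rule: rels_cases)
      case (add_left x z y)
      then show ?thesis
        unfolding tensor_rels_def using q
        by (intro UnI1 CollectI exI[of _ "x \<otimes>\<^bsub>M\<^esub> x'"] exI[of _ "z \<otimes>\<^bsub>M\<^esub> x'"] exI[of _ "y \<otimes>\<^bsub>N\<^esub> y'"])
          (simp add: frag_extend_diff pm_def M.l_distr)
    next
      case (add_right x y z)
      then show ?thesis
        unfolding tensor_rels_def using q
        by (intro UnI1 UnI2 CollectI exI[of _ "x \<otimes>\<^bsub>M\<^esub> x'"] exI[of _ "y \<otimes>\<^bsub>N\<^esub> y'"] exI[of _ "z \<otimes>\<^bsub>N\<^esub> y'"])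
          (simp add: frag_extend_diff pm_def N.l_distr)
    next
      case (balanced r x y)
      then show ?thesis
        unfolding tensor_rels_def using q
        by (intro UnI2 CollectI exI[of _ r] exI[of _ "x \<otimes>\<^bsub>M\<^esub> x'"] exI[of _ "y \<otimes>\<^bsub>N\<^esub> y'"])
          (simp add: frag_extend_diff pm_def M_smult N_smult)
    qed
    then show "frag_extend (\<lambda>p. frag_extend (pm p) (frag_of q)) c \<in> K"
      by (rule rels_in_K)
  qed
next
  case (diff a b)
  then show ?case by (simp add: bil_diff_right K_diff)
qed

lemma mult_pure:
  assumes "x \<in> carrier M" "y \<in> carrier N" "x' \<in> carrier M" "y' \<in> carrier N"
  shows "pure x y \<otimes>\<^bsub>T\<^esub> pure x' y' = pure (x \<otimes>\<^bsub>M\<^esub> x') (y \<otimes>\<^bsub>N\<^esub> y')"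
proof -
  let ?p = "frag_of (x, y)" and ?q = "frag_of (x', y')"
  have pq: "?p \<in> carrier F" "?q \<in> carrier F" using assms by simp_all
  have "K <#>\<^bsub>F\<^esub> {bil u v | u v. u \<in> coset ?p \<and> v \<in> coset ?q} = coset (pm (x, y) (x', y'))"
  proof (rule set_mult_coset)
    have "?p \<in> coset ?p" "?q \<in> coset ?q"
      by (simp_all add: mem_coset K_zero)
    then show "pm (x, y) (x', y') \<in> {bil u v | u v. u \<in> coset ?p \<and> v \<in> coset ?q}"
      unfolding bil_frag_of[symmetric] by blast
    fix d assume "d \<in> {bil u v | u v. u \<in> coset ?p \<and> v \<in> coset ?q}"
    then obtain u v where d: "d = bil u v" and uv: "u - ?p \<in> K" "v - ?q \<in> K"
      by (auto simp: mem_coset)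
    have v: "v \<in> carrier F"
      using F_add_closed[OF K_in_F[OF uv(2)] pq(2)] by simp
    have "bil (v - ?q) ?p \<in> K" "bil (u - ?p) v \<in> K"
      using bil_ker_left uv pq v by blast+
    moreover have "bil (v - ?q) ?p = bil ?p (v - ?q)"
      using bil_commute K_in_F[OF uv(2)] pq by blast
    \<comment> \<open>The representatives are exchanged one at a time:
      \<open>uv - pq = (u - p) v + p (v - q)\<close>.\<close>
    moreover have "d - pm (x, y) (x', y') = bil (u - ?p) v + bil ?p (v - ?q)"
      by (simp add: d bil_diff_left bil_diff_right bil_frag_of)
    ultimately show "d - pm (x, y) (x', y') \<in> K"
      using K_add by metis
  qed
  then show ?thesis
    by (simp add: tensor_def Let_def pure_eq_coset bil_def pm_def case_prod_unfold)
qed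

end

section \<open>Extension of scalars of a reduced order\<close>

lemma (in cring) cring_as_module: "cring (as_module R s)"
proof (rule cringI)
  show "abelian_group (as_module R s)"
    by (rule abelian_groupI) (auto simp: as_module_def a_ac intro: l_neg)
  show "comm_monoid (as_module R s)"
    by (rule comm_monoidI) (auto simp: as_module_def m_ac)
qed (simp add: as_module_def l_distr)

lemma Q_ring_simps [simp]:
  "carrier Q_ring = UNIV" "\<zero>\<^bsub>Q_ring\<^esub> = 0" "\<one>\<^bsub>Q_ring\<^esub> = 1"
  "x \<oplus>\<^bsub>Q_ring\<^esub> y = x + y" "x \<otimes>\<^bsub>Q_ring\<^esub> y = x * y"
  by (simp_all add: ring_of_type_algebra_def)

lemma Z_ring_carrier: "carrier Z_ring = UNIV"
  by (simp add: ring_of_type_algebra_def)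

interpretation Q: cring Q_ring
  by (rule cring_from_type_algebra)

lemma add_pow_Q_ring: "add_pow Q_ring (k::int) r = of_int k * r"
proof (induction k rule: int_induct[where k = 0])
  case base
  show ?case by (simp add: Q.add_pow_int_0)
next
  case (step1 i)
  then show ?case by (simp add: Q.add_pow_int_add Q.add_pow_int_1 algebra_simps)
next
  case (step2 i)
  have "add_pow Q_ring i r = add_pow Q_ring (i - 1) r + r"
    using Q.add_pow_int_add[of r "i - 1" 1] by (simp add: Q.add_pow_int_1)
  with step2 show ?case by (simp add: algebra_simps)
qed

locale reduced_order = cring A for A (structure) +
  assumes free: "free_fg (add_monoid A)"
    and reduced: "x \<in> carrier A \<Longrightarrow> x [^] (k::nat) = \<zero> \<Longrightarrow> x = \<zero>"
begin

text \<open>The \<open>SOME\<close> in \<open>order_trace\<close> picks one basis. Fixing that very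
  basis makes \<open>order_trace\<close> equal to \<open>tr\<close> by unfolding, so the results on
  \<open>tr\<close> carry over.\<close>

lemma order_trace_basis:
  obtains n h where "order_basis A n h" "order_trace A = order_basis.tr A n h"
proof -
  define nh where "nh = (SOME (n::nat, h). h \<in> iso (add_monoid A) (product_group {..<n} (\<lambda>_. integer_group)))"
  obtain n h where nh: "nh = (n, h)" by fastforce
  have "\<exists>p. case p of (n::nat, h) \<Rightarrow> h \<in> iso (add_monoid A) (product_group {..<n} (\<lambda>_. integer_group))"
    using free by (auto simp: free_fg_def is_iso_def)
  from someI_ex[OF this] have h: "h \<in> iso (add_monoid A) (product_group {..<n} (\<lambda>_. integer_group))"
    unfolding nh_def[symmetric] nh by simp
  interpret order_basis A n h
    by unfold_locales (rule h)
  have "order_trace A a = tr a" for a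
    unfolding order_trace_def nh_def[symmetric] nh tr_def zb.basis_def by simp
  then show ?thesis
    using that order_basis_axioms by blast
qed

lemma order_trace_add:
  "a \<in> carrier A \<Longrightarrow> b \<in> carrier A \<Longrightarrow> order_trace A (a \<oplus> b) = order_trace A a + order_trace A b"
  using order_trace_basis order_basis.tr_add by metis

lemma order_trace_nondegenerate:
  assumes "x \<in> carrier A" "\<And>a. a \<in> carrier A \<Longrightarrow> order_trace A (a \<otimes> x) = 0"
  shows "x = \<zero>"
proof -
  obtain n h where nh: "order_basis A n h" "order_trace A = order_basis.tr A n h"
    by (rule order_trace_basis)
  show ?thesis
    using order_basis.trace_form_nondegenerate[OF nh(1) reduced] assms nh(2) by simp
qed

lemma order_trace_represents:
  assumes "\<And>x y. x \<in> carrier A \<Longrightarrow> y \<in> carrier A \<Longrightarrow> f (x \<oplus> y) = f x + f y"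
  shows "\<exists>d z. d \<noteq> 0 \<and> z \<in> carrier A \<and> (\<forall>a\<in>carrier A. order_trace A (a \<otimes> z) = d * f a)"
proof -
  obtain n h where nh: "order_basis A n h" "order_trace A = order_basis.tr A n h"
    by (rule order_trace_basis)
  show ?thesis
    using order_basis.trace_form_represents[OF nh(1) reduced, where f = f] assms nh(2) by simp
qed

lemma order_trace_add_pow:
  assumes "a \<in> carrier A"
  shows "order_trace A (add_pow A (k::int) a) = k * order_trace A a"
  using additive_int_fun[of "\<lambda>k. order_trace A (add_pow A k a)" k] assms
  by (simp add: add_pow_int_add add_pow_int_closed add_pow_int_1 order_trace_add)

lemma Z_alg_simps [simp]:
  "carrier (Z_alg A) = carrier A" "\<zero>\<^bsub>Z_alg A\<^esub> = \<zero>" "\<one>\<^bsub>Z_alg A\<^esub> = \<one>"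
  "x \<oplus>\<^bsub>Z_alg A\<^esub> y = x \<oplus> y" "x \<otimes>\<^bsub>Z_alg A\<^esub> y = x \<otimes> y" "k \<odot>\<^bsub>Z_alg A\<^esub> x = add_pow A k x"
  by (simp_all add: Z_alg_def as_module_def)

lemma Z_alg_Q_simps [simp]:
  "carrier (Z_alg Q_ring) = UNIV" "\<zero>\<^bsub>Z_alg Q_ring\<^esub> = 0" "\<one>\<^bsub>Z_alg Q_ring\<^esub> = 1"
  "r \<oplus>\<^bsub>Z_alg Q_ring\<^esub> s = r + s" "r \<otimes>\<^bsub>Z_alg Q_ring\<^esub> s = r * s"
  "k \<odot>\<^bsub>Z_alg Q_ring\<^esub> r = of_int k * r"
  by (simp_all add: Z_alg_def as_module_def add_pow_Q_ring)

sublocale T: tensor_algebra Z_ring "Z_alg A" "Z_alg Q_ring"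
proof -
  have crings: "cring (Z_alg A)" "cring (Z_alg Q_ring)"
    unfolding Z_alg_def by (rule cring_as_module Q.cring_as_module)+
  then show "tensor_algebra Z_ring (Z_alg A) (Z_alg Q_ring)"
    by (intro tensor_algebra.intro tensor_pair.intro tensor_pair_axioms.intro tensor_algebra_axioms.intro)
      (auto simp: cring_def ring_def add_pow_int_closed add_pow_ldistr_int)
qed

sublocale tr: tensor_balanced Z_ring "Z_alg A" "Z_alg Q_ring" Q_ring
  "\<lambda>a q. of_int (order_trace A a) * q"
  by unfold_locales (auto simp: order_trace_add order_trace_add_pow algebra_simps)

abbreviation frac :: "'a \<Rightarrow> rat \<Rightarrow> 'a rationalized" where
  "frac \<equiv> pure_tensor Z_ring (Z_alg A) (Z_alg Q_ring)"

lemma AQ_abelian_group: "abelian_group (AQ A)"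
  unfolding AQ_def by (rule T.T_abelian_group)

lemma frac_closed [simp]: "a \<in> carrier A \<Longrightarrow> frac a r \<in> carrier (AQ A)"
  unfolding AQ_def by (simp add: T.pure_closed)

lemma frac_add: "a \<in> carrier A \<Longrightarrow> b \<in> carrier A \<Longrightarrow> frac (a \<oplus> b) r = frac a r \<oplus>\<^bsub>AQ A\<^esub> frac b r"
  using T.pure_add_left[of a b r] by (simp add: AQ_def)

lemma frac_scale: "a \<in> carrier A \<Longrightarrow> frac (add_pow A k a) r = frac a (of_int k * r)"
  using T.pure_balanced[of k a r] by (simp add: Z_ring_carrier)

lemma frac_mult:
  "a \<in> carrier A \<Longrightarrow> b \<in> carrier A \<Longrightarrow> frac a r \<otimes>\<^bsub>AQ A\<^esub> frac b s = frac (a \<otimes> b) (r * s)"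
  using T.mult_pure[of a r b s] by (simp add: AQ_def)

lemma frac_zero: "frac \<zero> r = \<zero>\<^bsub>AQ A\<^esub>"
  using T.pure_zero_left[of r] by (simp add: AQ_def)

lemma to_AQ_eq_frac: "to_AQ A a = frac a 1"
  by (simp add: to_AQ_def)

lemma AQ_one: "\<one>\<^bsub>AQ A\<^esub> = to_AQ A \<one>"
  unfolding AQ_def tensor_one to_AQ_def by simp

lemma trace_frac: "a \<in> carrier A \<Longrightarrow> trace_AQ A (frac a r) = of_int (order_trace A a) * r"
  unfolding trace_AQ_def by (simp add: tr.tensor_lift_pure)

lemma frac_common:
  assumes "a \<in> carrier A" "e \<noteq> 0"
  shows "frac a (1 / of_int d) = frac (add_pow A e a) (1 / of_int (d * e))"
  using assms by (simp add: frac_scale)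

text \<open>Sums are brought over the common denominator \<open>d * e\<close>, so a single integral
  denominator suffices for every element. Questions in the extension thereby reduce to questions
  about numerators in \<open>A\<close>.\<close>

lemma AQ_cases:
  assumes "z \<in> carrier (AQ A)"
  obtains a d where "a \<in> carrier A" "d > 0" "z = frac a (1 / of_int d)"
proof -
  have "\<exists>a d. a \<in> carrier A \<and> d > 0 \<and> z = frac a (1 / of_int d)"
    using assms unfolding AQ_def
  proof (induction z rule: T.tensor_induct)
    case zero
    show ?case
      using frac_zero[of 1] by (intro exI[of _ \<zero>] exI[of _ 1]) (simp add: AQ_def)
  next
    case (pure a r)
    obtain p d where r: "r = of_int p / of_int d" "d > 0"
      by (metis quotient_of_denom_pos' quotient_of_div surj_pair snd_conv)
    then have "frac a r = frac (add_pow A p a) (1 / of_int d)"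
      using pure by (simp add: frac_scale)
    then show ?case
      using pure r(2) add_pow_int_closed by auto
  next
    case (add s t)
    then obtain a d b e where *: "a \<in> carrier A" "d > 0" "s = frac a (1 / of_int d)"
      "b \<in> carrier A" "e > 0" "t = frac b (1 / of_int e)" by blast
    have "s = frac (add_pow A e a) (1 / of_int (d * e))" "t = frac (add_pow A d b) (1 / of_int (d * e))"
      using * frac_common[of a e d] frac_common[of b d e] by (simp_all add: mult.commute)
    then have "s \<oplus>\<^bsub>AQ A\<^esub> t = frac (add_pow A e a \<oplus> add_pow A d b) (1 / of_int (d * e))"
      using * by (simp add: frac_add add_pow_int_closed)
    moreover have "d * e > 0" using *(2,5) by simp
    moreover have "add_pow A e a \<oplus> add_pow A d b \<in> carrier A"
      using *(1,4) by (simp add: add_pow_int_closed)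
    ultimately show ?case
      unfolding AQ_def by blast
  qed
  with that show thesis by blast
qed

text \<open>Links \<open>A_hat\<close>, where the element of \<open>A\<close> stands on the right,
  with \<open>herm\<close>, where it stands on the left.\<close>

lemma AQ_mult_to_AQ_commute:
  assumes "z \<in> carrier (AQ A)" "a \<in> carrier A"
  shows "z \<otimes>\<^bsub>AQ A\<^esub> to_AQ A a = to_AQ A a \<otimes>\<^bsub>AQ A\<^esub> z"
  using assms(1) by (rule AQ_cases) (simp add: to_AQ_eq_frac frac_mult assms(2) m_comm)

text \<open>After cross-multiplication the two numerators have the same traces against
  \<open>A\<close>, and nondegeneracy over the integers applies. This is the uniqueness behind
  \<open>herm\<close>.\<close>

lemma AQ_eqI:
  assumes z: "z \<in> carrier (AQ A)" "z' \<in> carrier (AQ A)"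
    and tr: "\<And>a. a \<in> carrier A \<Longrightarrow>
      trace_AQ A (to_AQ A a \<otimes>\<^bsub>AQ A\<^esub> z) = trace_AQ A (to_AQ A a \<otimes>\<^bsub>AQ A\<^esub> z')"
  shows "z = z'"
proof -
  obtain c d where c: "c \<in> carrier A" "d > 0" "z = frac c (1 / of_int d)"
    using z(1) by (rule AQ_cases)
  obtain c' d' where c': "c' \<in> carrier A" "d' > 0" "z' = frac c' (1 / of_int d')"
    using z(2) by (rule AQ_cases)
  let ?u = "add_pow A d' c" and ?v = "add_pow A d c'"
  have uv: "?u \<in> carrier A" "?v \<in> carrier A"
    using c c' by (simp_all add: add_pow_int_closed)
  have "order_trace A (a \<otimes> ?u) = order_trace A (a \<otimes> ?v)" if a: "a \<in> carrier A" for a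
  proof -
    have "of_int (order_trace A (a \<otimes> c)) / of_int d = (of_int (order_trace A (a \<otimes> c')) / of_int d' :: rat)"
      using tr[OF a] a c c' by (simp add: to_AQ_eq_frac frac_mult trace_frac)
    then have "(of_int (d' * order_trace A (a \<otimes> c)) :: rat) = of_int (d * order_trace A (a \<otimes> c'))"
      using c(2) c'(2) by (simp add: field_simps)
    then have "d' * order_trace A (a \<otimes> c) = d * order_trace A (a \<otimes> c')"
      by (simp only: of_int_eq_iff)
    then show ?thesis
      using a c c' by (simp add: add_pow_rdistr_int order_trace_add_pow)
  qed
  then have "order_trace A (a \<otimes> (?u \<ominus> ?v)) = 0" if "a \<in> carrier A" for a
    using that uv order_trace_add[of "a \<otimes> (?u \<ominus> ?v)" "a \<otimes> ?v"]
    by (simp add: r_distr[symmetric] minus_eq a_assoc l_neg)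
  then have "?u \<ominus> ?v = \<zero>"
    using order_trace_nondegenerate uv by simp
  then have "?u = ?v"
    by (rule minus_eq_zeroD[OF uv])
  then show ?thesis
    using c c' frac_common[of c d' d] frac_common[of c' d d'] by (simp add: mult.commute)
qed

lemma to_AQ_closed [simp]: "a \<in> carrier A \<Longrightarrow> to_AQ A a \<in> carrier (AQ A)"
  by (simp add: to_AQ_eq_frac)

lemma to_AQ_add: "a \<in> carrier A \<Longrightarrow> b \<in> carrier A \<Longrightarrow> to_AQ A (a \<oplus> b) = to_AQ A a \<oplus>\<^bsub>AQ A\<^esub> to_AQ A b"
  by (simp add: to_AQ_eq_frac frac_add)

lemma trace_to_AQ_mult:
  "a \<in> carrier A \<Longrightarrow> b \<in> carrier A \<Longrightarrow>
    trace_AQ A (to_AQ A a \<otimes>\<^bsub>AQ A\<^esub> to_AQ A b) = of_int (order_trace A (a \<otimes> b))"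
  by (simp add: to_AQ_eq_frac frac_mult trace_frac)

text \<open>On images of \<open>A\<close> the rational trace form is the integral one, so
  nondegeneracy already separates elements.\<close>

lemma to_AQ_inj: "inj_on (to_AQ A) (carrier A)"
proof (rule inj_onI)
  fix x y assume xy: "x \<in> carrier A" "y \<in> carrier A" "to_AQ A x = to_AQ A y"
  have "order_trace A (a \<otimes> (x \<ominus> y)) = 0" if a: "a \<in> carrier A" for a
  proof -
    have "order_trace A (a \<otimes> x) = order_trace A (a \<otimes> y)"
      using trace_to_AQ_mult[OF a xy(1)] trace_to_AQ_mult[OF a xy(2)] xy(3) by simp
    then show ?thesis
      using a xy order_trace_add[of "a \<otimes> (x \<ominus> y)" "a \<otimes> y"]
      by (simp add: r_distr[symmetric] minus_eq a_assoc l_neg)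
  qed
  then have "x \<ominus> y = \<zero>"
    using order_trace_nondegenerate xy by simp
  then show "x = y"
    by (rule minus_eq_zeroD[OF xy(1,2)])
qed

lemma trace_AQ_mult_add:
  assumes "a \<in> carrier A" "z \<in> carrier (AQ A)" "z' \<in> carrier (AQ A)"
  shows "trace_AQ A (to_AQ A a \<otimes>\<^bsub>AQ A\<^esub> (z \<oplus>\<^bsub>AQ A\<^esub> z'))
    = trace_AQ A (to_AQ A a \<otimes>\<^bsub>AQ A\<^esub> z) + trace_AQ A (to_AQ A a \<otimes>\<^bsub>AQ A\<^esub> z')"
proof -
  obtain c d where c: "c \<in> carrier A" "d > 0" "z = frac c (1 / of_int d)"
    using assms(2) by (rule AQ_cases)
  obtain c' d' where c': "c' \<in> carrier A" "d' > 0" "z' = frac c' (1 / of_int d')"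
    using assms(3) by (rule AQ_cases)
  have z: "z = frac (add_pow A d' c) (1 / of_int (d * d'))" "z' = frac (add_pow A d c') (1 / of_int (d * d'))"
    using c c' frac_common[of c d' d] frac_common[of c' d d'] by (simp_all add: mult.commute)
  show ?thesis
    using assms(1) c(1) c'(1) unfolding z
    by (simp add: frac_add[symmetric] add_pow_int_closed to_AQ_eq_frac frac_mult trace_frac r_distr
        order_trace_add add_divide_distrib del: of_int_mult)
qed

text \<open>Dividing by the factor \<open>d\<close> of \<open>order_trace_represents\<close> makes
  the representation exact.\<close>

lemma A_hat_represents:
  assumes "\<And>x y. x \<in> carrier A \<Longrightarrow> y \<in> carrier A \<Longrightarrow> f (x \<oplus> y) = f x + (f y :: int)"
  shows "\<exists>z\<in>carrier (AQ A). \<forall>a\<in>carrier A. trace_AQ A (to_AQ A a \<otimes>\<^bsub>AQ A\<^esub> z) = of_int (f a)"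
proof -
  obtain d w where "d \<noteq> 0" "w \<in> carrier A" "\<forall>a\<in>carrier A. order_trace A (a \<otimes> w) = d * f a"
    using order_trace_represents[OF assms] by blast
  then show ?thesis
    by (intro bexI[of _ "frac w (1 / of_int d)"]) (simp_all add: to_AQ_eq_frac frac_mult trace_frac)
qed

end


section \<open>The hermitian product of a lattice over a reduced order\<close>

locale order_lattice = reduced_order A for A :: "'a bar_ring" (structure) +
  fixes L :: "('a, 'l) form_module"
  assumes bar_iso: "bar A \<in> ring_iso A A"
    and A_lattice: "A_lattice A L"
begin

sublocale L: module A L
  using A_lattice by (simp add: A_lattice_def)

lemma free_L: "free_fg (add_monoid L)"
  and form_add_left: "x \<in> carrier L \<Longrightarrow> y \<in> carrier L \<Longrightarrow> z \<in> carrier L \<Longrightarrow>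
    form L (x \<oplus>\<^bsub>L\<^esub> y) z = form L x z + form L y z"
  and form_add_right: "x \<in> carrier L \<Longrightarrow> y \<in> carrier L \<Longrightarrow> z \<in> carrier L \<Longrightarrow>
    form L z (x \<oplus>\<^bsub>L\<^esub> y) = form L z x + form L z y"
  and form_commute: "x \<in> carrier L \<Longrightarrow> y \<in> carrier L \<Longrightarrow> form L x y = form L y x"
  and form_pos: "x \<in> carrier L \<Longrightarrow> x \<noteq> \<zero>\<^bsub>L\<^esub> \<Longrightarrow> form L x x > 0"
  and form_adjoint: "a \<in> carrier A \<Longrightarrow> x \<in> carrier L \<Longrightarrow> y \<in> carrier L \<Longrightarrow>
    form L (a \<odot>\<^bsub>L\<^esub> x) y = form L x (bar A a \<odot>\<^bsub>L\<^esub> y)"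
  using A_lattice by (auto simp: A_lattice_def is_lattice_def)

lemma bar_closed [simp]: "a \<in> carrier A \<Longrightarrow> bar A a \<in> carrier A"
  and bar_mult: "a \<in> carrier A \<Longrightarrow> b \<in> carrier A \<Longrightarrow> bar A (a \<otimes> b) = bar A a \<otimes> bar A b"
  and bar_one: "bar A \<one> = \<one>"
  using bar_iso
  by (auto simp: ring_iso_def Ring.ring_hom_mult Ring.ring_hom_one intro: Ring.ring_hom_closed)

lemma bar_surj: "bar A ` carrier A = carrier A"
  using bar_iso by (simp add: ring_iso_def bij_betw_def)

text \<open>The prescribed traces are integers, so \<open>z\<close> lies in \<open>A_hat\<close>
  automatically. An identity for \<open>herm\<close> thus reduces to closure and a comparison of
  traces.\<close>

lemma herm_unique:
  assumes xy: "x \<in> carrier L" "y \<in> carrier L" and z: "z \<in> carrier (AQ A)"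
    and tr: "\<And>a. a \<in> carrier A \<Longrightarrow> trace_AQ A (to_AQ A a \<otimes>\<^bsub>AQ A\<^esub> z) = of_int (form L (a \<odot>\<^bsub>L\<^esub> x) y)"
  shows "herm A L x y = z"
  unfolding herm_def
proof (rule the_equality)
  show "z \<in> A_hat A \<and> (\<forall>a\<in>carrier A. trace_AQ A (to_AQ A a \<otimes>\<^bsub>AQ A\<^esub> z) = of_int (form L (a \<odot>\<^bsub>L\<^esub> x) y))"
    using z tr by (auto simp: A_hat_def AQ_mult_to_AQ_commute)
next
  fix z' assume "z' \<in> A_hat A \<and> (\<forall>a\<in>carrier A. trace_AQ A (to_AQ A a \<otimes>\<^bsub>AQ A\<^esub> z') = of_int (form L (a \<odot>\<^bsub>L\<^esub> x) y))"
  then show "z' = z"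
    using z tr by (intro AQ_eqI) (auto simp: A_hat_def)
qed

lemma
  assumes xy: "x \<in> carrier L" "y \<in> carrier L"
  shows herm_closed: "herm A L x y \<in> carrier (AQ A)"
    and trace_herm: "a \<in> carrier A \<Longrightarrow>
      trace_AQ A (to_AQ A a \<otimes>\<^bsub>AQ A\<^esub> herm A L x y) = of_int (form L (a \<odot>\<^bsub>L\<^esub> x) y)"
proof -
  have "\<exists>z\<in>carrier (AQ A). \<forall>a\<in>carrier A.
      trace_AQ A (to_AQ A a \<otimes>\<^bsub>AQ A\<^esub> z) = of_int (form L (a \<odot>\<^bsub>L\<^esub> x) y)"
    using xy by (intro A_hat_represents) (simp add: L.smult_l_distr form_add_left)
  then obtain z where z: "z \<in> carrier (AQ A)"
    "\<And>a. a \<in> carrier A \<Longrightarrow> trace_AQ A (to_AQ A a \<otimes>\<^bsub>AQ A\<^esub> z) = of_int (form L (a \<odot>\<^bsub>L\<^esub> x) y)"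
    by blast
  have "herm A L x y = z"
    using xy z by (rule herm_unique)
  with z show "herm A L x y \<in> carrier (AQ A)"
    and "a \<in> carrier A \<Longrightarrow> trace_AQ A (to_AQ A a \<otimes>\<^bsub>AQ A\<^esub> herm A L x y) = of_int (form L (a \<odot>\<^bsub>L\<^esub> x) y)"
    by auto
qed

lemma conj_module_simps [simp]:
  "carrier (conj_module A L) = carrier L" "\<zero>\<^bsub>conj_module A L\<^esub> = \<zero>\<^bsub>L\<^esub>"
  "x \<oplus>\<^bsub>conj_module A L\<^esub> y = x \<oplus>\<^bsub>L\<^esub> y" "a \<odot>\<^bsub>conj_module A L\<^esub> y = bar A a \<odot>\<^bsub>L\<^esub> y"
  by (simp_all add: conj_module_def)

lemma conj_abelian_group: "abelian_group (conj_module A L)"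
  by (rule abelian_groupI) (auto simp: L.a_ac intro: L.l_neg)

sublocale LL: tensor_module A L "conj_module A L"
  by (intro tensor_module.intro tensor_pair.intro tensor_pair_axioms.intro L.module_axioms
      L.abelian_group_axioms conj_abelian_group) simp_all

sublocale phi: tensor_balanced A L "conj_module A L" "AQ A" "herm A L"
proof (intro tensor_balanced.intro LL.tensor_pair_axioms AQ_abelian_group tensor_balanced_axioms.intro)
  interpret AQ: abelian_group "AQ A" by (rule AQ_abelian_group)
  fix x x' y assume *: "x \<in> carrier L" "y \<in> carrier (conj_module A L)"
  then show "herm A L x y \<in> carrier (AQ A)"
    by (simp add: herm_closed)
  show "herm A L (x \<oplus>\<^bsub>L\<^esub> x') y = herm A L x y \<oplus>\<^bsub>AQ A\<^esub> herm A L x' y" if "x' \<in> carrier L"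
    using * that
    by (intro herm_unique)
      (simp_all add: herm_closed trace_AQ_mult_add trace_herm L.smult_r_distr form_add_left)
  show "herm A L x (y \<oplus>\<^bsub>conj_module A L\<^esub> y') = herm A L x y \<oplus>\<^bsub>AQ A\<^esub> herm A L x y'"
    if "y' \<in> carrier (conj_module A L)" for y'
    using * that
    by (intro herm_unique)
      (simp_all add: herm_closed trace_AQ_mult_add trace_herm form_add_right)
  \<comment> \<open>Adjointness of the form is exactly compatibility with the conjugate action on
    the second factor.\<close>
  show "herm A L (r \<odot>\<^bsub>L\<^esub> x) y = herm A L x (r \<odot>\<^bsub>conj_module A L\<^esub> y)" if "r \<in> carrier A" for r
    using * that
    by (intro herm_unique)
      (simp_all add: herm_closed trace_herm form_adjoint[symmetric] L.smult_assoc1[symmetric] m_comm)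
qed

end

section \<open>Short vectors\<close>

lemma standard_lattice_simps [simp]:
  "carrier (standard_lattice A) = carrier A" "\<zero>\<^bsub>standard_lattice A\<^esub> = \<zero>\<^bsub>A\<^esub>"
  "x \<oplus>\<^bsub>standard_lattice A\<^esub> y = x \<oplus>\<^bsub>A\<^esub> y" "a \<odot>\<^bsub>standard_lattice A\<^esub> x = a \<otimes>\<^bsub>A\<^esub> x"
  "form (standard_lattice A) x y = order_trace A (x \<otimes>\<^bsub>A\<^esub> bar A y)"
  by (simp_all add: standard_lattice_def as_module_def module.defs form_module.defs)

text \<open>\<open>A_isomorphic\<close> is used with maps out of \<open>L\<close>, evaluation at the
  unit with maps into \<open>L\<close>; this passes between them. The restriction makes the inverse
  extensional again.\<close>

lemma A_isos_inverse:
  assumes h: "h \<in> A_isos A M N" and M: "abelian_group M"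
    and smult: "\<And>a x. a \<in> carrier A \<Longrightarrow> x \<in> carrier M \<Longrightarrow> a \<odot>\<^bsub>M\<^esub> x \<in> carrier M"
  shows "restrict (inv_into (carrier M) h) (carrier N) \<in> A_isos A N M"
proof -
  have iso: "h \<in> Group.iso (add_monoid M) (add_monoid N)"
    and lin: "\<And>a x. a \<in> carrier A \<Longrightarrow> x \<in> carrier M \<Longrightarrow> h (a \<odot>\<^bsub>M\<^esub> x) = a \<odot>\<^bsub>N\<^esub> h x"
    and fm: "\<And>x y. x \<in> carrier M \<Longrightarrow> y \<in> carrier M \<Longrightarrow> form N (h x) (h y) = form M x y"
    using h by (auto simp: A_isos_def module_iso_def)
  have bij: "bij_betw h (carrier M) (carrier N)"
    using iso by (simp add: Group.iso_def)
  let ?g = "inv_into (carrier M) h"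
  have g: "?g y \<in> carrier M" "h (?g y) = y" if "y \<in> carrier N" for y
    using that bij by (auto simp: bij_betw_def inv_into_into f_inv_into_f)
  have gh: "?g (h x) = x" if "x \<in> carrier M" for x
    using that bij by (simp add: bij_betw_def)
  have hN: "h x \<in> carrier N" if "x \<in> carrier M" for x
    using that bij by (auto simp: bij_betw_def)
  have hadd: "h (x \<oplus>\<^bsub>M\<^esub> y) = h x \<oplus>\<^bsub>N\<^esub> h y" if "x \<in> carrier M" "y \<in> carrier M" for x y
    using that iso by (auto simp: Group.iso_def Group.hom_def)
  have M_add: "x \<oplus>\<^bsub>M\<^esub> y \<in> carrier M" if "x \<in> carrier M" "y \<in> carrier M" for x y
    using that abelian_monoid.a_closed[OF abelian_group.axioms(1)[OF M]] by blast
  have add: "x \<oplus>\<^bsub>N\<^esub> y \<in> carrier N" "?g (x \<oplus>\<^bsub>N\<^esub> y) = ?g x \<oplus>\<^bsub>M\<^esub> ?g y"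
    if "x \<in> carrier N" "y \<in> carrier N" for x y
    using hadd[of "?g x" "?g y"] g that hN[OF M_add[of "?g x" "?g y"]] gh[OF M_add[of "?g x" "?g y"]]
    by simp_all
  have smult_N: "a \<odot>\<^bsub>N\<^esub> y \<in> carrier N" "?g (a \<odot>\<^bsub>N\<^esub> y) = a \<odot>\<^bsub>M\<^esub> ?g y"
    if "a \<in> carrier A" "y \<in> carrier N" for a y
    using lin[of a "?g y"] g that hN[OF smult[of a "?g y"]] gh[OF smult[of a "?g y"]]
    by simp_all
  have "bij_betw (restrict ?g (carrier N)) (carrier N) (carrier M)"
    using bij_betw_inv_into[OF bij] by (simp cong: bij_betw_cong)
  moreover have "form M (?g x) (?g y) = form N x y" if "x \<in> carrier N" "y \<in> carrier N" for x y
    using fm[of "?g x" "?g y"] g that by simp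
  ultimately show ?thesis
    using g add smult_N by (auto simp: A_isos_def module_iso_def Group.iso_def Group.hom_def)
qed

context order_lattice
begin

lemma form_zero_left: "y \<in> carrier L \<Longrightarrow> form L \<zero>\<^bsub>L\<^esub> y = 0"
  using form_add_left[of "\<zero>\<^bsub>L\<^esub>" "\<zero>\<^bsub>L\<^esub>" y] by simp

lemma form_minus_left:
  assumes "x \<in> carrier L" "y \<in> carrier L" "z \<in> carrier L"
  shows "form L (x \<ominus>\<^bsub>L\<^esub> y) z = form L x z - form L y z"
  using form_add_left[of "x \<ominus>\<^bsub>L\<^esub> y" y z] assms by (simp add: L.minus_eq L.a_assoc L.l_neg)

lemma form_minus_right:
  assumes "x \<in> carrier L" "y \<in> carrier L" "z \<in> carrier L"
  shows "form L z (x \<ominus>\<^bsub>L\<^esub> y) = form L z x - form L z y"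
  using form_add_right[of "x \<ominus>\<^bsub>L\<^esub> y" y z] assms by (simp add: L.minus_eq L.a_assoc L.l_neg)

lemma form_nonneg: "x \<in> carrier L \<Longrightarrow> form L x x \<ge> 0"
  using form_pos[of x] form_zero_left[of x] by (cases "x = \<zero>\<^bsub>L\<^esub>") auto

lemma form_smult_right:
  assumes "a \<in> carrier A" "x \<in> carrier L" "y \<in> carrier L"
  shows "form L x (a \<odot>\<^bsub>L\<^esub> y) = form L (bar A a \<odot>\<^bsub>L\<^esub> x) y"
  using assms form_adjoint[of a y x] by (simp add: form_commute)

lemma form_of_herm:
  assumes "x \<in> carrier L" "y \<in> carrier L" "c \<in> carrier A" "herm A L x y = to_AQ A c" "a \<in> carrier A"
  shows "form L (a \<odot>\<^bsub>L\<^esub> x) y = order_trace A (a \<otimes> c)"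
  using trace_herm[of x y a] trace_to_AQ_mult[of a c] assms by simp

lemma herm_eq_to_AQI:
  assumes "x \<in> carrier L" "y \<in> carrier L" "c \<in> carrier A"
    and "\<And>a. a \<in> carrier A \<Longrightarrow> form L (a \<odot>\<^bsub>L\<^esub> x) y = order_trace A (a \<otimes> c)"
  shows "herm A L x y = to_AQ A c"
  using assms by (intro herm_unique) (simp_all add: trace_to_AQ_mult)

text \<open>Stated for products already in \<open>A\<close>, as are those of multiples of a short
  vector and, by \<open>invertible_herm\<close>, all products in an invertible lattice; the scalars
  can then be computed inside \<open>A\<close>.\<close>

lemma herm_smult_left:
  assumes "x \<in> carrier L" "y \<in> carrier L" "c \<in> carrier A" "herm A L x y = to_AQ A c" "a \<in> carrier A"
  shows "herm A L (a \<odot>\<^bsub>L\<^esub> x) y = to_AQ A (a \<otimes> c)"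
  using assms form_of_herm[OF assms(1-4)]
  by (intro herm_eq_to_AQI) (simp_all add: L.smult_assoc1[symmetric] m_assoc)

lemma herm_smult_right:
  assumes "x \<in> carrier L" "y \<in> carrier L" "c \<in> carrier A" "herm A L x y = to_AQ A c" "a \<in> carrier A"
  shows "herm A L x (a \<odot>\<^bsub>L\<^esub> y) = to_AQ A (bar A a \<otimes> c)"
  using assms form_of_herm[OF assms(1-4)]
  by (intro herm_eq_to_AQI) (simp_all add: form_smult_right L.smult_assoc1[symmetric] m_ac)

lemma to_AQ_zero: "to_AQ A \<zero> = \<zero>\<^bsub>AQ A\<^esub>"
  by (simp add: to_AQ_eq_frac frac_zero)

lemma short_iff: "e \<in> short_vectors A L \<longleftrightarrow> e \<in> carrier L \<and> herm A L e e = to_AQ A \<one>"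
  by (simp add: short_vectors_def AQ_one)

text \<open>The product of \<open>a e\<close> with \<open>e\<close> is \<open>a\<close>, so the
  coefficient can be read off.\<close>

lemma short_faithful:
  assumes e: "e \<in> short_vectors A L" and ab: "a \<in> carrier A" "b \<in> carrier A" "a \<odot>\<^bsub>L\<^esub> e = b \<odot>\<^bsub>L\<^esub> e"
  shows "a = b"
proof -
  have "to_AQ A a = to_AQ A b"
    using herm_smult_left[of e e \<one> a] herm_smult_left[of e e \<one> b] e ab by (simp add: short_iff)
  then show ?thesis
    using to_AQ_inj ab by (simp add: inj_on_eq_iff)
qed

lemma short_smult_iff:
  assumes "e \<in> short_vectors A L" "a \<in> carrier A"
  shows "a \<odot>\<^bsub>L\<^esub> e \<in> short_vectors A L \<longleftrightarrow> a \<otimes> bar A a = \<one>"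
proof -
  have "herm A L e (a \<odot>\<^bsub>L\<^esub> e) = to_AQ A (bar A a)"
    using herm_smult_right[of e e \<one> a] assms by (simp add: short_iff)
  then have "herm A L (a \<odot>\<^bsub>L\<^esub> e) (a \<odot>\<^bsub>L\<^esub> e) = to_AQ A (a \<otimes> bar A a)"
    using assms by (intro herm_smult_left) (simp_all add: short_iff)
  then show ?thesis
    using assms to_AQ_inj by (simp add: short_iff inj_on_eq_iff)
qed

lemma form_short:
  assumes "e \<in> short_vectors A L" "a \<in> carrier A" "b \<in> carrier A"
  shows "form L (a \<odot>\<^bsub>L\<^esub> e) (b \<odot>\<^bsub>L\<^esub> e) = order_trace A (a \<otimes> bar A b)"
  using herm_smult_right[of e e \<one> b] assms by (intro form_of_herm) (simp_all add: short_iff)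

lemma invertible_herm:
  assumes "invertible_lattice A L" "x \<in> carrier L" "y \<in> carrier L"
  shows "\<exists>c\<in>carrier A. herm A L x y = to_AQ A c"
proof -
  have "phi_map A L (LL.pure x y) \<in> to_AQ A ` carrier A"
    using assms LL.pure_closed[of x y] by (auto simp: invertible_lattice_def Let_def)
  then show ?thesis
    using assms phi.tensor_lift_pure[of x y] by (auto simp: phi_map_def)
qed

text \<open>A bijective composite has an injective first factor. Injectivity is the form in which
  invertibility annihilates tensors.\<close>

lemma phi_map_inj:
  assumes "invertible_lattice A L"
  shows "inj_on (phi_map A L) (carrier LL.T)"
proof -
  have "inv_into (carrier A) (to_AQ A) \<circ> phi_map A L
      \<in> module_iso A LL.T (as_module A (monoid.mult A))"
    using assms by (simp add: invertible_lattice_def Let_def)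
  then have "inj_on (inv_into (carrier A) (to_AQ A) \<circ> phi_map A L) (carrier LL.T)"
    by (simp add: module_iso_def Group.iso_def bij_betw_def)
  then show ?thesis
    by (rule inj_on_imageI2)
qed

text \<open>If \<open>x\<close> is orthogonal to \<open>e\<close>, then \<open>x \<otimes> e\<close> vanishes because \<^term>\<open>phi_map A L\<close> is injective, and
  the map \<open>u \<otimes> v \<mapsto> herm e v \<odot> u\<close> sends \<open>x \<otimes> e\<close> to \<open>x\<close>.\<close>

lemma short_orthogonal_zero:
  assumes inv: "invertible_lattice A L" and e: "e \<in> short_vectors A L"
    and x: "x \<in> carrier L" "herm A L x e = to_AQ A \<zero>"
  shows "x = \<zero>\<^bsub>L\<^esub>"
proof -
  have eL: "e \<in> carrier L" and ee: "herm A L e e = to_AQ A \<one>"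
    using e by (simp_all add: short_iff)
  have "\<forall>v. \<exists>c. v \<in> carrier L \<longrightarrow> c \<in> carrier A \<and> herm A L e v = to_AQ A c"
    using invertible_herm[OF inv eL] by blast
  then obtain c where c: "\<And>v. v \<in> carrier L \<Longrightarrow> c v \<in> carrier A"
    and hc: "\<And>v. v \<in> carrier L \<Longrightarrow> herm A L e v = to_AQ A (c v)"
    by metis
  have c_eqI: "c v = a" if "v \<in> carrier L" "a \<in> carrier A" "herm A L e v = to_AQ A a" for v a
    using that c hc to_AQ_inj by (metis inj_on_eq_iff)
  interpret f: tensor_balanced A L "conj_module A L" L "\<lambda>u v. c v \<odot>\<^bsub>L\<^esub> u"
  proof (intro tensor_balanced.intro LL.tensor_pair_axioms L.abelian_group_axioms tensor_balanced_axioms.intro)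
    fix u v assume uv: "u \<in> carrier L" "v \<in> carrier (conj_module A L)"
    then show "c v \<odot>\<^bsub>L\<^esub> u \<in> carrier L" using c by simp
    show "c v \<odot>\<^bsub>L\<^esub> (u \<oplus>\<^bsub>L\<^esub> u') = c v \<odot>\<^bsub>L\<^esub> u \<oplus>\<^bsub>L\<^esub> c v \<odot>\<^bsub>L\<^esub> u'" if "u' \<in> carrier L" for u'
      using uv c that by (simp add: L.smult_r_distr)
    show "c (v \<oplus>\<^bsub>conj_module A L\<^esub> v') \<odot>\<^bsub>L\<^esub> u = c v \<odot>\<^bsub>L\<^esub> u \<oplus>\<^bsub>L\<^esub> c v' \<odot>\<^bsub>L\<^esub> u"
      if v': "v' \<in> carrier (conj_module A L)" for v'
    proof -
      have "c (v \<oplus>\<^bsub>L\<^esub> v') = c v \<oplus> c v'"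
        using uv v' c eL phi.f_add_right[of e v v'] by (intro c_eqI) (simp_all add: hc to_AQ_add)
      then show ?thesis
        using uv v' c by (simp add: L.smult_l_distr)
    qed
    \<comment> \<open>The product with \<open>e\<close> is conjugate-linear in \<open>v\<close>, and
      the action on the second factor is conjugated as well; the two conjugations cancel, so
      \<open>c\<close> is linear for that action.\<close>
    show "c v \<odot>\<^bsub>L\<^esub> (r \<odot>\<^bsub>L\<^esub> u) = c (r \<odot>\<^bsub>conj_module A L\<^esub> v) \<odot>\<^bsub>L\<^esub> u" if r: "r \<in> carrier A" for r
    proof -
      have "c (bar A r \<odot>\<^bsub>L\<^esub> v) = r \<otimes> c v"
        using uv r c hc eL phi.f_balanced[of r e v] herm_smult_left[of e v "c v" r]
        by (intro c_eqI) simp_all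
      then show ?thesis
        using uv r c by (simp add: L.smult_assoc1[symmetric] m_comm)
    qed
  qed
  have "phi_map A L (LL.pure x e) = phi_map A L \<zero>\<^bsub>LL.T\<^esub>"
    using x eL phi.tensor_lift_pure[of x e] phi.tensor_lift_zero by (simp add: phi_map_def to_AQ_zero)
  then have "LL.pure x e = \<zero>\<^bsub>LL.T\<^esub>"
    using LL.pure_closed[of x e] x eL abelian_monoid.zero_closed[OF abelian_group.axioms(1)[OF LL.T_abelian_group]]
    by (intro inj_onD[OF phi_map_inj[OF inv]]) simp_all
  then have "c e \<odot>\<^bsub>L\<^esub> x = \<zero>\<^bsub>L\<^esub>"
    using f.tensor_lift_pure[of x e] f.tensor_lift_zero x eL by simp
  then show ?thesis
    using c_eqI[OF eL one_closed ee] x by simp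
qed

lemma short_generates:
  assumes inv: "invertible_lattice A L" and e: "e \<in> short_vectors A L" and x: "x \<in> carrier L"
  shows "\<exists>a\<in>carrier A. x = a \<odot>\<^bsub>L\<^esub> e"
proof -
  have eL: "e \<in> carrier L" and ee: "herm A L e e = to_AQ A \<one>"
    using e by (simp_all add: short_iff)
  obtain c where c: "c \<in> carrier A" "herm A L x e = to_AQ A c"
    using invertible_herm[OF inv x eL] by blast
  have ce: "herm A L (c \<odot>\<^bsub>L\<^esub> e) e = to_AQ A c"
    using herm_smult_left[OF eL eL one_closed ee c(1)] c by simp
  \<comment> \<open>The difference is shown to have product 0 with \<open>e\<close> by its traces;
    \<open>a \<otimes> \<zero>\<close> is the shape that \<open>herm_eq_to_AQI\<close>
    expects.\<close>
  have "form L (a \<odot>\<^bsub>L\<^esub> (x \<ominus>\<^bsub>L\<^esub> c \<odot>\<^bsub>L\<^esub> e)) e = order_trace A (a \<otimes> \<zero>)" if a: "a \<in> carrier A" for a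
  proof -
    have "a \<odot>\<^bsub>L\<^esub> (x \<ominus>\<^bsub>L\<^esub> c \<odot>\<^bsub>L\<^esub> e) = a \<odot>\<^bsub>L\<^esub> x \<ominus>\<^bsub>L\<^esub> a \<odot>\<^bsub>L\<^esub> (c \<odot>\<^bsub>L\<^esub> e)"
      using a c x eL by (simp add: L.minus_eq L.smult_r_distr L.smult_r_minus)
    then show ?thesis
      using a c x eL form_of_herm[OF x eL c a] form_of_herm[OF _ eL c(1) ce a] order_trace_add[of \<zero> \<zero>]
      by (simp add: form_minus_left)
  qed
  moreover have clo: "c \<odot>\<^bsub>L\<^esub> e \<in> carrier L" "x \<ominus>\<^bsub>L\<^esub> c \<odot>\<^bsub>L\<^esub> e \<in> carrier L"
    using c(1) x eL by simp_all
  ultimately have "herm A L (x \<ominus>\<^bsub>L\<^esub> c \<odot>\<^bsub>L\<^esub> e) e = to_AQ A \<zero>"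
    by (intro herm_eq_to_AQI[OF _ eL zero_closed])
  with inv e clo(2) have "x \<ominus>\<^bsub>L\<^esub> c \<odot>\<^bsub>L\<^esub> e = \<zero>\<^bsub>L\<^esub>"
    by (rule short_orthogonal_zero)
  with x clo(1) have "x = c \<odot>\<^bsub>L\<^esub> e"
    by (rule L.minus_eq_zeroD)
  with c(1) show ?thesis ..
qed

section \<open>Isometries with the standard lattice\<close>

text \<open>Linearity determines \<open>f\<close> by its value at the unit. Isometry turns the form
  of \<open>a f(1)\<close> with \<open>f(1)\<close> into the trace of \<open>a\<close>, and these
  traces characterise the product 1.\<close>

lemma A_isos_standardD:
  assumes "f \<in> A_isos A (standard_lattice A) L"
  shows A_isos_one_short: "f \<one> \<in> short_vectors A L"
    and A_isos_eq: "f = (\<lambda>a\<in>carrier A. a \<odot>\<^bsub>L\<^esub> f \<one>)"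
    and A_isos_surj: "f ` carrier A = carrier L"
proof -
  have lin: "f (a \<otimes> b) = a \<odot>\<^bsub>L\<^esub> f b" if "a \<in> carrier A" "b \<in> carrier A" for a b
    using assms that by (auto simp: A_isos_def module_iso_def)
  have ext: "f \<in> extensional (carrier A)"
    and frm: "\<And>a b. a \<in> carrier A \<Longrightarrow> b \<in> carrier A \<Longrightarrow> form L (f a) (f b) = order_trace A (a \<otimes> bar A b)"
    using assms by (auto simp: A_isos_def)
  show surj: "f ` carrier A = carrier L"
    using assms by (simp add: A_isos_def module_iso_def Group.iso_def bij_betw_def)
  have fa: "f a = a \<odot>\<^bsub>L\<^esub> f \<one>" if "a \<in> carrier A" for a
    using lin[of a \<one>] that by simp
  show "f = (\<lambda>a\<in>carrier A. a \<odot>\<^bsub>L\<^esub> f \<one>)"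
    using ext by (rule extensionalityI) (simp_all flip: fa)
  have "f \<one> \<in> carrier L" using surj by blast
  moreover have "herm A L (f \<one>) (f \<one>) = to_AQ A \<one>"
    using \<open>f \<one> \<in> carrier L\<close> frm[of _ \<one>]
    by (intro herm_eq_to_AQI) (simp_all add: fa[symmetric] bar_one)
  ultimately show "f \<one> \<in> short_vectors A L"
    by (simp add: short_iff)
qed

lemma short_A_iso:
  assumes "invertible_lattice A L" and e: "e \<in> short_vectors A L"
  shows "(\<lambda>a\<in>carrier A. a \<odot>\<^bsub>L\<^esub> e) \<in> A_isos A (standard_lattice A) L"
proof -
  have eL: "e \<in> carrier L" using e by (simp add: short_iff)
  have "bij_betw (\<lambda>a\<in>carrier A. a \<odot>\<^bsub>L\<^esub> e) (carrier A) (carrier L)"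
    using short_generates[OF assms] short_faithful[OF e] eL
    by (auto simp: bij_betw_def inj_on_def image_iff)
  then show ?thesis
    using eL e
    by (auto simp: A_isos_def module_iso_def Group.iso_def Group.hom_def L.smult_l_distr
        L.smult_assoc1 form_short)
qed

text \<open>Sending \<open>a\<close> to the tensor of \<open>a e\<close> and \<open>e\<close> is
  onto the tensor product, and \<open>phi_map\<close> takes that tensor back to \<open>a\<close>. So
  the two are mutually inverse.\<close>

lemma cyclic_imp_invertible:
  assumes e: "e \<in> short_vectors A L" and gen: "\<And>x. x \<in> carrier L \<Longrightarrow> \<exists>a\<in>carrier A. x = a \<odot>\<^bsub>L\<^esub> e"
  shows "invertible_lattice A L"
proof -
  have eL: "e \<in> carrier L" and ee: "herm A L e e = to_AQ A \<one>"
    using e by (simp_all add: short_iff)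
  have phi: "phi_map A L (LL.pure (a \<odot>\<^bsub>L\<^esub> e) e) = to_AQ A a" if "a \<in> carrier A" for a
    using phi.tensor_lift_pure[of "a \<odot>\<^bsub>L\<^esub> e" e] herm_smult_left[OF eL eL one_closed ee that] that eL
    by (simp add: phi_map_def)
  define g where "g = inv_into (carrier A) (to_AQ A) \<circ> phi_map A L"
  have g: "g (LL.pure (a \<odot>\<^bsub>L\<^esub> e) e) = a" if "a \<in> carrier A" for a
    using phi[OF that] that to_AQ_inj by (simp add: g_def)
  \<comment> \<open>Scalars of the second factor move to the first, which collapses every tensor to
    one with right factor \<open>e\<close>.\<close>
  have T_e: "\<exists>x\<in>carrier L. t = LL.pure x e" if "t \<in> carrier LL.T" for t
    using that
  proof (induction t rule: LL.tensor_induct)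
    case zero
    show ?case using LL.pure_zero_left[of e] eL by auto
  next
    case (pure x y)
    then obtain b where b: "b \<in> carrier A" "y = b \<odot>\<^bsub>L\<^esub> e"
      using gen[of y] by auto
    \<comment> \<open>A scalar crossing the tensor sign acts on the second factor through
      \<open>bar\<close>, so \<open>b\<close> has to be written as a conjugate.\<close>
    then obtain c where c: "c \<in> carrier A" "b = bar A c"
      using bar_surj by blast
    with b show ?case
      using LL.pure_balanced[of c x e] pure eL by (intro bexI[of _ "c \<odot>\<^bsub>L\<^esub> x"]) simp_all
  next
    case (add s t)
    then show ?case using LL.pure_add_left eL by (metis L.a_closed conj_module_simps(1))
  qed
  then have T_cases: "\<exists>a\<in>carrier A. t = LL.pure (a \<odot>\<^bsub>L\<^esub> e) e" if "t \<in> carrier LL.T" for t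
    using that gen by metis
  have clo: "LL.pure (a \<odot>\<^bsub>L\<^esub> e) e \<in> carrier LL.T" if "a \<in> carrier A" for a
    using that eL LL.pure_closed by simp
  have bij: "bij_betw g (carrier LL.T) (carrier A)"
  proof (rule bij_betwI')
    fix s t assume "s \<in> carrier LL.T" "t \<in> carrier LL.T"
    then show "g s = g t \<longleftrightarrow> s = t" using T_cases g by metis
  next
    fix t assume "t \<in> carrier LL.T"
    then show "g t \<in> carrier A" using T_cases g by metis
  next
    fix a assume "a \<in> carrier A"
    then show "\<exists>t\<in>carrier LL.T. a = g t" using clo g by metis
  qed
  have add: "g (s \<oplus>\<^bsub>LL.T\<^esub> t) = g s \<oplus> g t" if st: "s \<in> carrier LL.T" "t \<in> carrier LL.T" for s t
  proof -
    obtain a b where ab: "a \<in> carrier A" "s = LL.pure (a \<odot>\<^bsub>L\<^esub> e) e" "b \<in> carrier A" "t = LL.pure (b \<odot>\<^bsub>L\<^esub> e) e"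
      using T_cases st by blast
    have "s \<oplus>\<^bsub>LL.T\<^esub> t = LL.pure ((a \<oplus> b) \<odot>\<^bsub>L\<^esub> e) e"
      using ab eL LL.pure_add_left[of "a \<odot>\<^bsub>L\<^esub> e" "b \<odot>\<^bsub>L\<^esub> e" e] by (simp add: L.smult_l_distr)
    then show ?thesis using ab g by simp
  qed
  have smult: "g (r \<odot>\<^bsub>LL.T\<^esub> t) = r \<otimes> g t" if r: "r \<in> carrier A" and t: "t \<in> carrier LL.T" for r t
  proof -
    obtain a where a: "a \<in> carrier A" "t = LL.pure (a \<odot>\<^bsub>L\<^esub> e) e"
      using T_cases t by blast
    have "r \<odot>\<^bsub>LL.T\<^esub> t = LL.pure ((r \<otimes> a) \<odot>\<^bsub>L\<^esub> e) e"
      using a r eL LL.smult_pure[of r "a \<odot>\<^bsub>L\<^esub> e" e] by (simp add: L.smult_assoc1)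
    then show ?thesis using a r g by simp
  qed
  have "phi_map A L ` carrier LL.T \<subseteq> to_AQ A ` carrier A"
    using T_cases phi by fastforce
  moreover have "g \<in> module_iso A LL.T (as_module A (monoid.mult A))"
    using bij add smult
    by (auto simp: module_iso_def Group.iso_def Group.hom_def as_module_def bij_betw_def)
  ultimately show ?thesis
    by (simp add: invertible_lattice_def Let_def g_def)
qed

section \<open>Vectors of given length and roots of unity\<close>

text \<open>A vector is determined by its inner products with a basis: a difference orthogonal to
  the basis is orthogonal to itself. For fixed norm these inner products are bounded
  integers.\<close>

lemma finite_norm_eq: "finite {x \<in> carrier L. form L x x = c}"
proof -
  obtain n h where "h \<in> Group.iso (add_monoid L) (product_group {..<n::nat} (\<lambda>_. integer_group))"
    using free_L by (auto simp: free_fg_def is_iso_def)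
  moreover have "comm_group (add_monoid L)" by (rule L.a_comm_group)
  ultimately interpret B: z_basis "add_monoid L" n h
    by (intro z_basis.intro z_basis_axioms.intro)
  have b: "B.basis i \<in> carrier L" for i using B.basis_closed by simp
  let ?X = "{x \<in> carrier L. form L x x = c}"
  let ?v = "\<lambda>x. \<lambda>i\<in>{..<n}. form L x (B.basis i)"
  let ?N = "\<lambda>i. c + form L (B.basis i) (B.basis i)"
  show ?thesis
  proof (rule inj_on_finite)
    show "inj_on ?v ?X"
    proof (rule inj_onI)
      fix x y assume xy: "x \<in> ?X" "y \<in> ?X" "?v x = ?v y"
      have "form L x (B.basis i) = form L y (B.basis i)" if "i < n" for i
        using fun_cong[OF xy(3), of i] that by simp
      then have "form L (x \<ominus>\<^bsub>L\<^esub> y) z = 0" if "z \<in> carrier L" for z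
        using B.additive_zeroI[of "form L (x \<ominus>\<^bsub>L\<^esub> y)" z] xy that b
        by (simp add: form_add_right form_minus_left)
      then have "x \<ominus>\<^bsub>L\<^esub> y = \<zero>\<^bsub>L\<^esub>"
        using form_pos[of "x \<ominus>\<^bsub>L\<^esub> y"] xy by fastforce
      with xy(1,2) show "x = y" by (auto dest: L.minus_eq_zeroD)
    qed
    show "?v ` ?X \<subseteq> (\<Pi>\<^sub>E i\<in>{..<n}. {- ?N i..?N i})"
    proof (intro image_subsetI PiE_I)
      fix x i assume x: "x \<in> ?X"
      let ?b = "B.basis i"
      \<comment> \<open>The norms of the sum and the difference of \<open>x\<close> and
        \<open>?b\<close> are nonnegative, which bounds \<open>2 * form L x ?b\<close> from both
        sides by \<open>?N i\<close>: a crude Cauchy-Schwarz inequality, whose factor 2 is given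
        away afterwards.\<close>
      have "form L (x \<oplus>\<^bsub>L\<^esub> ?b) (x \<oplus>\<^bsub>L\<^esub> ?b) = c + 2 * form L x ?b + form L ?b ?b"
        using x b[of i] by (simp add: form_add_left form_add_right form_commute[of ?b x])
      moreover have "form L (x \<ominus>\<^bsub>L\<^esub> ?b) (x \<ominus>\<^bsub>L\<^esub> ?b) = c - 2 * form L x ?b + form L ?b ?b"
        using x b[of i] by (simp add: form_minus_left form_minus_right form_commute[of ?b x])
      ultimately have "\<bar>2 * form L x ?b\<bar> \<le> ?N i"
        using form_nonneg[of "x \<oplus>\<^bsub>L\<^esub> ?b"] form_nonneg[of "x \<ominus>\<^bsub>L\<^esub> ?b"] x b[of i] by auto
      then show "i \<in> {..<n} \<Longrightarrow> ?v x i \<in> {- ?N i..?N i}" by auto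
    qed auto
    show "finite (\<Pi>\<^sub>E i\<in>{..<n}. {- ?N i..?N i})"
      by (intro finite_PiE) auto
  qed
qed

lemma bar_pow: "a \<in> carrier A \<Longrightarrow> bar A (a [^] (k::nat)) = bar A a [^] k"
  by (induction k) (simp_all add: bar_one bar_mult)

lemma unit_norm_imp_root_of_unity:
  assumes e: "e \<in> short_vectors A L" and a: "a \<in> carrier A" "a \<otimes> bar A a = \<one>"
  shows "a \<in> mu_group A"
proof -
  have eL: "e \<in> carrier L" using e by (simp add: short_iff)
  have norm: "form L (a [^] k \<odot>\<^bsub>L\<^esub> e) (a [^] k \<odot>\<^bsub>L\<^esub> e) = order_trace A \<one>" for k :: nat
  proof -
    have "a [^] k \<otimes> bar A (a [^] k) = \<one>"
      using a nat_pow_distrib[of a "bar A a" k] by (simp add: bar_pow)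
    then show ?thesis using form_short[OF e, of "a [^] k" "a [^] k"] a by simp
  qed
  have "range (\<lambda>k::nat. a [^] k \<odot>\<^bsub>L\<^esub> e) \<subseteq> {x \<in> carrier L. form L x x = order_trace A \<one>}"
    using norm a eL by auto
  then have "finite (range (\<lambda>k::nat. a [^] k \<odot>\<^bsub>L\<^esub> e))"
    using finite_norm_eq finite_subset by blast
  \<comment> \<open>Infinitely many exponents meet finitely many vectors, so two powers of
    \<open>a\<close> agree on \<open>e\<close> and hence in \<open>A\<close>.\<close>
  then have "\<not> inj (\<lambda>k::nat. a [^] k \<odot>\<^bsub>L\<^esub> e)"
    using finite_imageD infinite_UNIV_nat by blast
  then obtain i j :: nat where "i < j" "a [^] i \<odot>\<^bsub>L\<^esub> e = a [^] j \<odot>\<^bsub>L\<^esub> e"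
    using linorder_injI[of "\<lambda>k::nat. a [^] k \<odot>\<^bsub>L\<^esub> e"] by blast
  then have ij: "i < j" "a [^] i = a [^] j"
    using short_faithful[OF e] a by auto
  \<comment> \<open>The conjugate power inverts \<open>a [^] i\<close>, which allows cancelling it
    from \<open>a [^] i = a [^] j\<close>.\<close>
  have "bar A a [^] i \<otimes> a [^] i = \<one>"
    using a nat_pow_distrib[of "bar A a" a i] by (simp add: m_comm)
  moreover have "a [^] j = a [^] i \<otimes> a [^] (j - i)"
    using ij(1) a by (simp add: nat_pow_mult)
  ultimately have "a [^] (j - i) = \<one>"
    using ij(2) a by (metis bar_closed l_one m_assoc nat_pow_closed)
  then show ?thesis
    using ij(1) a by (auto simp: mu_group_def intro!: exI[of _ "j - i"])
qed

text \<open>With \<open>u\<close> the norm of a root of unity, multiplication by each \<open>u\<^sup>k\<close> is a positive operator, and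
  for \<open>y = u x - x\<close> the sum of the \<open>\<langle>u\<^sup>k y, y\<rangle>\<close> over a period of \<open>u\<close> telescopes to \<open>0\<close>; the term
  with \<open>k = 0\<close> gives \<open>y = 0\<close>.\<close>

lemma root_of_unity_imp_unit_norm:
  assumes e: "e \<in> short_vectors A L" and "\<zeta> \<in> mu_group A"
  shows "\<zeta> \<otimes> bar A \<zeta> = \<one>"
proof -
  have eL: "e \<in> carrier L" using e by (simp add: short_iff)
  obtain m :: nat where \<zeta>: "\<zeta> \<in> carrier A" and m: "m > 0" "\<zeta> [^] m = \<one>"
    using assms(2) by (auto simp: mu_group_def)
  define u where "u = \<zeta> \<otimes> bar A \<zeta>"
  have u: "u \<in> carrier A" using \<zeta> by (simp add: u_def)
  have um: "u [^] m = \<one>"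
    using \<zeta> m by (simp add: u_def nat_pow_distrib bar_pow[symmetric] bar_one)
  have norm: "form L x (u \<odot>\<^bsub>L\<^esub> y) = form L (\<zeta> \<odot>\<^bsub>L\<^esub> x) (\<zeta> \<odot>\<^bsub>L\<^esub> y)"
    if "x \<in> carrier L" "y \<in> carrier L" for x y
    using that \<zeta> form_adjoint[of \<zeta> x "\<zeta> \<odot>\<^bsub>L\<^esub> y"]
    by (simp add: u_def m_comm[of \<zeta>] L.smult_assoc1)
  have self_adjoint: "form L (u \<odot>\<^bsub>L\<^esub> x) y = form L x (u \<odot>\<^bsub>L\<^esub> y)" if "x \<in> carrier L" "y \<in> carrier L" for x y
    using that \<zeta> u norm[of x y] norm[of y x]
      form_commute[of "u \<odot>\<^bsub>L\<^esub> x" y] form_commute[of "\<zeta> \<odot>\<^bsub>L\<^esub> x" "\<zeta> \<odot>\<^bsub>L\<^esub> y"] by simp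
  \<comment> \<open>Self-adjointness moves one of two factors \<open>u\<close> to the other
    argument, so \<open>k + 2\<close> at \<open>x\<close> becomes \<open>k\<close> at
    \<open>u x\<close>. Hence the induction by steps of two, whose base cases are the norms of
    \<open>x\<close> and of \<open>\<zeta> x\<close>.\<close>
  have pos: "form L (u [^] k \<odot>\<^bsub>L\<^esub> x) x \<ge> 0" if "x \<in> carrier L" for k :: nat and x
    using that
  proof (induction k arbitrary: x rule: induct_nat_012)
    case 0
    then show ?case by (simp add: form_nonneg)
  next
    case 1
    then show ?case
      using \<zeta> u by (simp add: self_adjoint norm form_nonneg)
  next
    case (ge2 k)
    have "u [^] Suc (Suc k) \<odot>\<^bsub>L\<^esub> x = u \<odot>\<^bsub>L\<^esub> (u [^] k \<odot>\<^bsub>L\<^esub> (u \<odot>\<^bsub>L\<^esub> x))"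
      using ge2.prems u by (simp add: L.smult_assoc1[symmetric] m_ac)
    then show ?case
      using ge2.IH(1)[of "u \<odot>\<^bsub>L\<^esub> x"] ge2.prems u by (simp add: self_adjoint del: nat_pow_Suc)
  qed
  define y where "y = u \<odot>\<^bsub>L\<^esub> e \<ominus>\<^bsub>L\<^esub> e"
  have y: "y \<in> carrier L" using u eL by (simp add: y_def)
  have "form L (u [^] k \<odot>\<^bsub>L\<^esub> y) y = form L (u [^] Suc k \<odot>\<^bsub>L\<^esub> e) y - form L (u [^] k \<odot>\<^bsub>L\<^esub> e) y" for k :: nat
  proof -
    have "u [^] k \<odot>\<^bsub>L\<^esub> y = u [^] Suc k \<odot>\<^bsub>L\<^esub> e \<ominus>\<^bsub>L\<^esub> u [^] k \<odot>\<^bsub>L\<^esub> e"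
      using u eL by (simp add: y_def L.minus_eq L.smult_r_distr L.smult_r_minus L.smult_assoc1)
    then show ?thesis
      using u eL y by (simp add: form_minus_left del: nat_pow_Suc)
  qed
  then have "(\<Sum>k<m. form L (u [^] k \<odot>\<^bsub>L\<^esub> y) y) = form L (u [^] m \<odot>\<^bsub>L\<^esub> e) y - form L (u [^] (0::nat) \<odot>\<^bsub>L\<^esub> e) y"
    using sum_lessThan_telescope[of "\<lambda>k. form L (u [^] k \<odot>\<^bsub>L\<^esub> e) y" m] by simp
  then have "(\<Sum>k<m. form L (u [^] k \<odot>\<^bsub>L\<^esub> y) y) = 0"
    by (simp add: um)
  then have "\<forall>k\<in>{..<m}. form L (u [^] k \<odot>\<^bsub>L\<^esub> y) y = 0"
    using pos[OF y] by (subst (asm) sum_nonneg_eq_0_iff) auto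
  with m(1) have "form L (u [^] (0::nat) \<odot>\<^bsub>L\<^esub> y) y = 0"
    by blast
  then have "y = \<zero>\<^bsub>L\<^esub>"
    using form_pos[OF y] y by fastforce
  then have "u \<odot>\<^bsub>L\<^esub> e = \<one> \<odot>\<^bsub>L\<^esub> e"
    using L.minus_eq_zeroD[of "u \<odot>\<^bsub>L\<^esub> e" e] u eL by (simp add: y_def)
  then have "u = \<one>"
    using short_faithful[OF e u one_closed] by simp
  then show ?thesis by (simp add: u_def)
qed

end

theorem theorem11p1:
  fixes A :: "'a bar_ring" and L :: "('a, 'l) form_module"
  assumes "CM_order A" and "A_lattice A L"
  shows "(invertible_lattice A L \<longrightarrow>
            bij_betw (\<lambda>f. f \<one>\<^bsub>A\<^esub>) (A_isos A (standard_lattice A) L) (short_vectors A L))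
       \<and> (invertible_lattice A L \<longrightarrow>
            (\<forall>e \<in> short_vectors A L. carrier L = {a \<odot>\<^bsub>L\<^esub> e | a. a \<in> carrier A}))
       \<and> (A_isomorphic A L (standard_lattice A) \<longleftrightarrow>
            invertible_lattice A L \<and> short_vectors A L \<noteq> {})
       \<and> (invertible_lattice A L \<longrightarrow>
            (\<forall>e \<in> short_vectors A L.
               bij_betw (\<lambda>\<zeta>. \<zeta> \<odot>\<^bsub>L\<^esub> e) (mu_group A) (short_vectors A L)))"
proof -
  have "cring A" using assms(1) by (simp add: CM_order_def is_order_def)
  then interpret order_lattice A L
    using assms
    by (intro order_lattice.intro reduced_order.intro reduced_order_axioms.intro order_lattice_axioms.intro)
      (auto simp: CM_order_def is_order_def)
  have std: "abelian_group (standard_lattice A)"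
    by (rule abelian_groupI) (auto simp: a_ac intro: l_neg)
  show ?thesis
  proof (intro conjI impI ballI iffI)
    assume inv: "invertible_lattice A L"
    show "bij_betw (\<lambda>f. f \<one>\<^bsub>A\<^esub>) (A_isos A (standard_lattice A) L) (short_vectors A L)"
    proof (rule bij_betwI')
      fix f g assume fg: "f \<in> A_isos A (standard_lattice A) L" "g \<in> A_isos A (standard_lattice A) L"
      show "f \<one>\<^bsub>A\<^esub> = g \<one>\<^bsub>A\<^esub> \<longleftrightarrow> f = g"
        using A_isos_eq[OF fg(1)] A_isos_eq[OF fg(2)] by metis
    next
      fix f assume "f \<in> A_isos A (standard_lattice A) L"
      then show "f \<one>\<^bsub>A\<^esub> \<in> short_vectors A L" by (rule A_isos_one_short)
    next
      fix e assume "e \<in> short_vectors A L"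
      then show "\<exists>f\<in>A_isos A (standard_lattice A) L. e = f \<one>\<^bsub>A\<^esub>"
        using short_A_iso[OF inv] by (intro bexI[of _ "\<lambda>a\<in>carrier A. a \<odot>\<^bsub>L\<^esub> e"]) (auto simp: short_iff)
    qed
  next
    fix e assume "invertible_lattice A L" "e \<in> short_vectors A L"
    then show "carrier L = {a \<odot>\<^bsub>L\<^esub> e | a. a \<in> carrier A}"
      using short_generates by (auto simp: short_iff)
  next
    assume "A_isomorphic A L (standard_lattice A)"
    then obtain h where "h \<in> A_isos A L (standard_lattice A)"
      by (auto simp: A_isomorphic_def)
    \<comment> \<open>The given map leaves \<open>L\<close>, whereas the short vector is the value
      at the unit of a map into \<open>L\<close>.\<close>
    from A_isos_inverse[OF this L.abelian_group_axioms L.smult_closed]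
    obtain f where f: "f \<in> A_isos A (standard_lattice A) L" by blast
    show "short_vectors A L \<noteq> {}"
      using A_isos_one_short[OF f] by blast
    show "invertible_lattice A L"
    proof (rule cyclic_imp_invertible[OF A_isos_one_short[OF f]])
      fix x assume "x \<in> carrier L"
      then obtain a where "a \<in> carrier A" "x = f a"
        using A_isos_surj[OF f] by blast
      then show "\<exists>a\<in>carrier A. x = a \<odot>\<^bsub>L\<^esub> f \<one>\<^bsub>A\<^esub>"
        using A_isos_eq[OF f] by (metis restrict_apply')
    qed
  next
    assume "invertible_lattice A L \<and> short_vectors A L \<noteq> {}"
    then obtain e where "invertible_lattice A L" "e \<in> short_vectors A L" by blast
    from short_A_iso[OF this] show "A_isomorphic A L (standard_lattice A)"
      using A_isos_inverse[OF _ std] unfolding A_isomorphic_def by fastforce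
  next
    fix e assume inv: "invertible_lattice A L" and e: "e \<in> short_vectors A L"
    show "bij_betw (\<lambda>\<zeta>. \<zeta> \<odot>\<^bsub>L\<^esub> e) (mu_group A) (short_vectors A L)"
    proof (rule bij_betwI')
      fix a b assume "a \<in> mu_group A" "b \<in> mu_group A"
      then show "a \<odot>\<^bsub>L\<^esub> e = b \<odot>\<^bsub>L\<^esub> e \<longleftrightarrow> a = b"
        using short_faithful[OF e] by (auto simp: mu_group_def)
    next
      fix a assume "a \<in> mu_group A"
      then show "a \<odot>\<^bsub>L\<^esub> e \<in> short_vectors A L"
        using root_of_unity_imp_unit_norm[OF e] short_smult_iff[OF e] by (simp add: mu_group_def)
    next
      fix x assume x: "x \<in> short_vectors A L"
      then obtain a where "a \<in> carrier A" "x = a \<odot>\<^bsub>L\<^esub> e"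
        using short_generates[OF inv e] by (auto simp: short_iff)
      then show "\<exists>a\<in>mu_group A. x = a \<odot>\<^bsub>L\<^esub> e"
        using x short_smult_iff[OF e] unit_norm_imp_root_of_unity[OF e] by blast
    qed
  qed
qed

end
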